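(* Let $n\in\mathbb{N}$, $\beta\in(0,1)$, and $\mathbf{a}=(a_1,\dots,a_n)$ with $a_j\ge0$ for all $j$ and $\|\mathbf{a}\|=1$. Let ${}_1\mathfrak{H}^\beta,\dots,{}_n\mathfrak{H}^\beta$ be independent $\beta$-stable subordinators and, for $\mathbf{x}=(x_1,\dots,x_n)\in\mathbb{R}^n_+$, let $$\mathscr{H}_\beta(\mathbf{x})=\sum_{j=1}^na_j^{1/\beta}\;{}_j\mathfrak{H}^\beta_{x_j}.$$ Then $$\Pr\{\mathscr{H}_\beta(\mathbf{x})\in ds\}/ds=h_\beta(s,\mathbf{a}\cdot\mathbf{x}).$$ Moreover, let $\mathscr{X}_\beta(t)=({}_1X^\beta_t,\dots,{}_nX^\beta_t)$, $t>0$, be the inverse of $\mathscr{H}_\beta$, in the sense that $$\Pr\{{}_1X^\beta_t>x_1,\dots,{}_nX^\beta_t>x_n\}=\Pr\{\mathscr{H}_\beta(\mathbf{x})<t\},\qquad\mathbf{x}\in\mathbb{R}^n_+.$$ Then the law (density) of $\mathscr{X}_\beta(t)$ is $$p_\beta(\mathbf{x},t)=\frac{a_{(n)}}{t^{n\beta}}\,W_{-\beta,1-n\beta}\left(-\frac{\mathbf{a}\cdot\mathbf{x}}{t^\beta}\right),\qquad a_{(n)}=a_1a_2\cdots a_n.$$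
   Context: $\mathbb{R}^n_+$ is the non-negative orthant and $\mathbf{a}\cdot\mathbf{x}=\sum_ka_kx_k$. The $\beta$-stable subordinator $\mathfrak{H}^\beta_t$ satisfies $\mathbb{E}e^{-\xi\mathfrak{H}^\beta_t}=e^{-t\xi^\beta}$, $\xi\geq 0$, and $h_\beta(\cdot,t)$ is its density. The Wright function is $W_{\mu,\rho}(z)=\sum_{k\ge0}\frac{z^k}{k!\,\Gamma(\mu k+\rho)}$, $\mu>-1$, $\rho,z\in\mathbb{C}$ (with $1/\Gamma=0$ at the poles of $\Gamma$). *)

theory Defs
  imports "HOL-Probability.Probability"
begin

text \<open>The Wright function; \<open>rGamma\<close> is the reciprocal Gamma function, which vanishes at the
  poles of Gamma. The type \<open>'a\<close> is \<open>real\<close> or \<open>complex\<close>; the series converges for \<open>\<mu> > -1\<close>.\<close>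

definition wright :: "real \<Rightarrow> 'a \<Rightarrow> 'a \<Rightarrow> 'a::Gamma" where
  "wright \<mu> \<rho> z = (\<Sum>k. z ^ k / fact k * rGamma (of_real \<mu> * of_nat k + \<rho>))"

text \<open>Processes \<open>H\<close> are indexed by \<open>{0..}\<close>; values of \<open>H\<close> at negative times are irrelevant.
  Left limits of paths exist by monotonicity.\<close>

definition subordinator :: "'a measure \<Rightarrow> (real \<Rightarrow> 'a \<Rightarrow> real) \<Rightarrow> bool" where
  "subordinator M H \<longleftrightarrow>
     prob_space M \<and>
     (\<forall>t\<ge>0. H t \<in> borel_measurable M) \<and>
     (AE \<omega> in M. H 0 \<omega> = 0) \<and>
     (AE \<omega> in M. mono_on {0..} (\<lambda>t. H t \<omega>) \<and> (\<forall>t\<ge>0. continuous (at_right t) (\<lambda>t. H t \<omega>))) \<and>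
     (\<forall>(m::nat) (\<tau>::nat \<Rightarrow> real). 0 \<le> \<tau> 0 \<and> mono \<tau> \<longrightarrow>
        prob_space.indep_vars M (\<lambda>_. borel) (\<lambda>i \<omega>. H (\<tau> (Suc i)) \<omega> - H (\<tau> i) \<omega>) {..<m}) \<and>
     (\<forall>s\<ge>0. \<forall>t\<ge>0. distr M borel (\<lambda>\<omega>. H (s + t) \<omega> - H s \<omega>) = distr M borel (H t))"

definition stable_subordinator :: "real \<Rightarrow> 'a measure \<Rightarrow> (real \<Rightarrow> 'a \<Rightarrow> real) \<Rightarrow> bool" where
  "stable_subordinator \<beta> M H \<longleftrightarrow>
     subordinator M H \<and>
     (\<forall>t\<ge>0. \<forall>\<xi>\<ge>0. (\<integral>\<omega>. exp (- \<xi> * H t \<omega>) \<partial>M) = exp (- t * \<xi> powr \<beta>))"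

text \<open>Independence of whole processes, as random elements of the path space \<open>\<real>\<close> to the power \<open>{0..}\<close>.\<close>

definition independent_processes :: "'a measure \<Rightarrow> ('n \<Rightarrow> real \<Rightarrow> 'a \<Rightarrow> real) \<Rightarrow> bool" where
  "independent_processes M H \<longleftrightarrow>
     prob_space.indep_vars M (\<lambda>_. Pi\<^sub>M {0..} (\<lambda>_. borel)) (\<lambda>j \<omega>. \<lambda>t\<in>{0..}. H j t \<omega>) UNIV"

definition nonneg_orthant :: "(real ^ 'n) set" where
  "nonneg_orthant = {x. \<forall>j. 0 \<le> x $ j}"

definition stable_sum ::
    "real \<Rightarrow> real ^ 'n \<Rightarrow> ('n::finite \<Rightarrow> real \<Rightarrow> 'a \<Rightarrow> real) \<Rightarrow> real ^ 'n \<Rightarrow> 'a \<Rightarrow> real" where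
  "stable_sum \<beta> a H x \<omega> = (\<Sum>j\<in>UNIV. (a $ j) powr (1 / \<beta>) * H j (x $ j) \<omega>)"

text \<open>The inverse at level \<open>t\<close> takes extended real values: if \<open>a $ j = 0\<close>, its \<open>j\<close>-th coordinate is
  infinite almost surely. Real-valued vectors are covered through the coercion \<open>ereal\<close>.\<close>

definition is_inverse_at ::
    "'b measure \<Rightarrow> ('n::finite \<Rightarrow> 'b \<Rightarrow> ereal) \<Rightarrow> 'a measure \<Rightarrow> (real ^ 'n \<Rightarrow> 'a \<Rightarrow> real) \<Rightarrow> real \<Rightarrow> bool" where
  "is_inverse_at N X M S t \<longleftrightarrow>
     prob_space N \<and> (\<forall>j. X j \<in> borel_measurable N) \<and>
     (\<forall>x\<in>nonneg_orthant.
        measure N {\<omega> \<in> space N. \<forall>j. ereal (x $ j) < X j \<omega>} =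
        measure M {\<omega> \<in> space M. S x \<omega> < t})"

definition finite_event :: "'b measure \<Rightarrow> ('n \<Rightarrow> 'b \<Rightarrow> ereal) \<Rightarrow> 'b set" where
  "finite_event N X = {\<omega> \<in> space N. \<forall>j. \<bar>X j \<omega>\<bar> \<noteq> \<infinity>}"

text \<open>\<open>p\<close> is the density of \<open>X\<close> on the orthant. \<open>distributed\<close> is applied to the restriction of the
  measure to \<open>finite_event\<close> (in general a subprobability measure), so the law of \<open>X\<close> on finite
  vectors is \<open>p\<close> times Lebesgue measure, and carries no mass off the orthant.
  The nonnegativity of \<open>p\<close> is required because \<open>ennreal\<close> truncates negative reals.\<close>

definition has_orthant_density ::
    "'b measure \<Rightarrow> ('n::finite \<Rightarrow> 'b \<Rightarrow> ereal) \<Rightarrow> (real ^ 'n \<Rightarrow> real) \<Rightarrow> bool" where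
  "has_orthant_density N X p \<longleftrightarrow>
     (\<forall>x\<in>nonneg_orthant. 0 \<le> p x) \<and>
     distributed (restrict_space N (finite_event N X)) lborel
       (\<lambda>\<omega>. \<chi> j. real_of_ereal (X j \<omega>)) (\<lambda>x. ennreal (indicator nonneg_orthant x * p x))"

end

theory Submission
  imports Defs "HOL-Complex_Analysis.Conformal_Mappings" "HOL-Real_Asymp.Real_Asymp"
begin

text \<open>
  By independence, \<open>stable_sum \<beta> a H x\<close> has the Laplace transform \<open>\<xi> \<mapsto> exp (- (a \<bullet> x) * \<xi> powr \<beta>)\<close>,
  which is that of one stable subordinator at time \<open>a \<bullet> x\<close> (\<open>stable_sum_law\<close>). The rest is
  a one-dimensional fact and a change from survival functions to densities.

  The one-dimensional fact is \<open>stable_law_lessThan\<close>: a law on the half-line with Laplace transform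
  \<open>exp (- \<tau> * \<xi> powr \<beta>)\<close> gives the interval \<open>{..<b}\<close>, \<open>b > 0\<close>, the mass
  \<open>wright (- \<beta>) 1 (- \<tau> / b powr \<beta>)\<close>. In particular the transform determines the law, which proves the
  first assertion. For the formula, let \<open>T\<close> have such a law. For real \<open>x > 0\<close> the mean of
  \<open>1 / (x + T)\<close> is the integral of \<open>exp (- x * r - \<tau> * r powr \<beta>)\<close> over \<open>r > 0\<close>, hence \<open>1 / x\<close> times an everywhere
  convergent power series in \<open>x powr (- \<beta>)\<close>. Both expressions are holomorphic off the negative
  axis, so they agree there. A primitive of this identity expresses the mean argument of the complex
  number \<open>w + T\<close> through the primitive of the series (\<open>expectation_Im_Ln\<close>). As \<open>w\<close> tends to \<open>- b\<close> from above,
  the argument tends to \<open>pi\<close> times the indicator of \<open>T < b\<close>, apart from a possible atom at \<open>b\<close>, while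
  the reflection formula for Gamma turns the series into \<open>pi\<close> times the Wright function.

  For the inverse, put \<open>V m = wright (- \<beta>) (1 - m * \<beta>)\<close>, so that \<open>V (m + 1)\<close> is the derivative of \<open>V m\<close>, and
  \<open>c = a / t powr \<beta>\<close>. The survival function of \<open>X\<close> on the orthant is \<open>x \<mapsto> V 0 (- (c \<bullet> x))\<close>. Differencing
  it in one coordinate at a time shows that the probability of a half-open box is the integral over the
  box of \<open>(-1) ^ n\<close> times the mixed derivative of order \<open>n\<close>, which is the asserted density
  (\<open>measure_box_eq_integral\<close>). The function \<open>z \<mapsto> V n (- z)\<close> need not be nonnegative on the half-line:
  for \<open>\<beta> = 1/2\<close> and \<open>n = 3\<close> its value at 0 is \<open>1 / Gamma (-1/2) < 0\<close>. The density is nonnegative because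
  an inverse \<open>X\<close> is assumed to exist: its box integrals are probabilities, and it is continuous
  (\<open>nonneg_if_hbox_integrals_nonneg\<close>). If some \<open>a $ j\<close> vanishes, then \<open>X j\<close> is infinite almost surely, and both the law
  on finite vectors and the density are zero.
\<close>

section \<open>Power series built from Gamma values\<close>

lemma Gamma_real_plus1:
  fixes x :: real
  assumes "0 < x"
  shows "Gamma (x + 1) = x * Gamma x"
  using assms by (intro Gamma_plus1) (auto elim!: nonpos_Ints_cases')

text \<open>Log-convexity of the Gamma function, applied to \<open>x + \<beta> = (1 - \<beta>) x + \<beta> (x + 1)\<close>. Its purpose is the
  ratio test below: the factor \<open>x powr \<beta>\<close> grows more slowly than the factor from \<open>fact\<close>, because
  \<open>\<beta> < 1\<close>.\<close>

lemma Gamma_add_le_powr: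
  fixes x \<beta> :: real
  assumes "0 < x" "0 < \<beta>" "\<beta> < 1"
  shows "Gamma (x + \<beta>) \<le> Gamma x * x powr \<beta>"
proof -
  have "(ln \<circ> Gamma) ((1 - \<beta>) *\<^sub>R x + \<beta> *\<^sub>R (x + 1)) \<le> (1 - \<beta>) * (ln \<circ> Gamma) x + \<beta> * (ln \<circ> Gamma) (x + 1)"
    using assms by (intro convex_onD[OF log_convex_Gamma_real]) auto
  also have "(1 - \<beta>) *\<^sub>R x + \<beta> *\<^sub>R (x + 1) = x + \<beta>"
    by (simp add: algebra_simps)
  also have "Gamma (x + 1) = x * Gamma x"
    using assms by (intro Gamma_real_plus1) auto
  hence "(ln \<circ> Gamma) (x + 1) = ln x + ln (Gamma x)"
    using assms Gamma_real_pos[OF assms(1)] by (simp add: ln_mult_pos)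
  finally have "ln (Gamma (x + \<beta>)) \<le> ln (Gamma x) + \<beta> * ln x"
    by (simp add: algebra_simps)
  also have "\<dots> = ln (Gamma x * x powr \<beta>)"
    using assms Gamma_real_pos[OF assms(1)] by (simp add: ln_mult_pos ln_powr)
  finally show ?thesis
    using assms Gamma_real_pos[of x] Gamma_real_pos[of "x+\<beta>"] by (subst (asm) ln_le_cancel_iff) auto
qed

lemma summable_Gamma_fact:
  fixes z :: "'a :: {real_normed_field, banach}"
  assumes "0 < \<beta>" "\<beta> < 1"
  shows "summable (\<lambda>k. of_real (Gamma (\<beta> * real k + 1) / fact k) * z ^ k)"
proof -
  have "(\<lambda>k. norm z * (real k + 1) powr (\<beta> - 1)) \<longlonglongrightarrow> 0"
    using assms by real_asymp
  hence "eventually (\<lambda>k. norm z * (real k + 1) powr (\<beta> - 1) < 1/2) sequentially"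
    by (rule order_tendstoD) auto
  then obtain N where N: "norm z * (real k + 1) powr (\<beta> - 1) < 1/2" if "k \<ge> N" for k
    unfolding eventually_sequentially by auto
  show ?thesis
  proof (rule summable_ratio_test[of "1/2" N])
    fix k assume k: "N \<le> k"
    let ?x = "\<beta> * real k + 1"
    have pos: "?x > 0" using assms by (intro add_nonneg_pos) auto
    have "Gamma (\<beta> * real (Suc k) + 1) = Gamma (?x + \<beta>)" by (simp add: algebra_simps)
    also have "\<dots> \<le> Gamma ?x * ?x powr \<beta>" using assms pos by (intro Gamma_add_le_powr) auto
    also have "\<dots> \<le> Gamma ?x * (real k + 1) powr \<beta>"
      using assms pos Gamma_real_pos[OF pos]
      by (intro mult_left_mono powr_mono2) (auto simp: mult_left_le_one_le)
    finally have "Gamma (\<beta> * real (Suc k) + 1) / fact (Suc k) * norm z \<le> 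
        Gamma ?x * (real k + 1) powr \<beta> / fact (Suc k) * norm z"
      by (intro mult_right_mono divide_right_mono) auto
    also have "\<dots> = Gamma ?x / fact k * (norm z * (real k + 1) powr (\<beta> - 1))"
      by (simp add: powr_diff field_simps)
    also have "\<dots> \<le> Gamma ?x / fact k * (1/2)"
      using N[OF k] Gamma_real_pos[OF pos] by (intro mult_left_mono) auto
    finally have *: "Gamma (\<beta> * real (Suc k) + 1) / fact (Suc k) * norm z * norm z ^ k \<le> Gamma ?x / fact k * (1/2) * norm z ^ k"
      by (rule mult_right_mono) auto
    have "Gamma (\<beta> * real (Suc k) + 1) \<ge> 0" "Gamma ?x \<ge> 0"
      using assms pos by (auto intro!: less_imp_le[OF Gamma_real_pos] add_nonneg_pos)
    thus "norm (of_real (Gamma (\<beta> * real (Suc k) + 1) / fact (Suc k)) * z ^ Suc k)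
         \<le> 1/2 * norm (of_real (Gamma (\<beta> * real k + 1) / fact k) * z ^ k)"
      using * by (simp add: norm_mult norm_power norm_divide mult_ac del: fact_Suc of_nat_Suc)
  qed auto
qed

lemma has_bochner_integral_Gamma:
  fixes c x :: real
  assumes "c \<ge> 0" "x > 0"
  shows "has_bochner_integral lborel (\<lambda>r. indicator {0<..} r * (r powr c * exp (- x * r))) (Gamma (c + 1) / x powr (c + 1))"
proof (rule has_bochner_integral_nn_integral)
  let ?f = "\<lambda>r. indicator {0<..} r * (r powr c * exp (- x * r)) :: real"
  have "(\<integral>\<^sup>+r. ennreal (?f r) \<partial>lborel) = (\<integral>\<^sup>+r. ennreal (?f (r / x)) / ennreal x \<partial>lborel)"
    using nn_integral_real_affine[of "\<lambda>r. ennreal (?f r)" "1/x" 0] assms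
    by (subst nn_integral_divide) (simp_all add: divide_ennreal_def inverse_ennreal inverse_eq_divide mult.commute)
  also have "\<dots> = (\<integral>\<^sup>+r. ennreal (1 / x powr (c + 1)) * ennreal (indicator {0..} r * r powr (c + 1 - 1) / exp r) \<partial>lborel)"
  proof (intro nn_integral_cong)
    fix r :: real
    have "?f (r / x) / x = 1 / x powr (c + 1) * (indicator {0..} r * r powr (c + 1 - 1) / exp r)"
      using assms by (auto simp: indicator_def powr_divide powr_add exp_minus field_simps)
    thus "ennreal (?f (r / x)) / ennreal x = ennreal (1 / x powr (c + 1)) * ennreal (indicator {0..} r * r powr (c + 1 - 1) / exp r)"
      using assms by (simp add: divide_ennreal flip: ennreal_mult'')
  qed
  also have "\<dots> = ennreal (1 / x powr (c + 1)) * ennreal (Gamma (c + 1))"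
    using assms by (subst nn_integral_cmult) (auto simp: Gamma_conv_nn_integral_real)
  also have "\<dots> = ennreal (Gamma (c + 1) / x powr (c + 1))"
    using assms by (simp flip: ennreal_mult')
  finally show "(\<integral>\<^sup>+r. ennreal (?f r) \<partial>lborel) = ennreal (Gamma (c + 1) / x powr (c + 1))" .
qed (use assms in \<open>auto intro!: less_imp_le[OF Gamma_real_pos] divide_nonneg_nonneg\<close>)

text \<open>Expand \<open>exp (- \<tau> * r powr \<beta>)\<close> and integrate term by term. Because \<open>\<beta> < 1\<close>, the series of the
  integrals of absolute values still converges, for every \<open>x > 0\<close>.\<close>

lemma laplace_exp_powr:
  fixes x \<beta> \<tau> :: real
  assumes \<beta>: "0 < \<beta>" "\<beta> < 1" and x: "0 < x"
  shows "(\<integral>r. indicator {0<..} r * (exp (- x * r) * exp (- \<tau> * r powr \<beta>)) \<partial>lborel) =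
           (\<Sum>k. Gamma (\<beta> * real k + 1) / fact k * (- \<tau> / x powr \<beta>) ^ k) / x"
proof -
  define f where "f = (\<lambda>k r. indicator {0<..} r * ((-\<tau>) ^ k / fact k * (r powr (\<beta> * real k) * exp (- x * r))))"
  have f_eq: "f k r = (-\<tau>) ^ k / fact k * (indicator {0<..} r * (r powr (\<beta> * real k) * exp (- x * r)))" for k r
    by (simp add: f_def)
  have *: "has_bochner_integral lborel (f k) ((-\<tau>) ^ k / fact k * (Gamma (\<beta> * real k + 1) / x powr (\<beta> * real k + 1)))" for k
    unfolding f_eq using \<beta> x by (intro has_bochner_integral_mult_right has_bochner_integral_Gamma) auto
  have norm_f: "norm (f k r) = \<bar>\<tau>\<bar> ^ k / fact k * (indicator {0<..} r * (r powr (\<beta> * real k) * exp (- x * r)))" for k r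
    by (simp add: f_def abs_mult power_abs)
  have **: "has_bochner_integral lborel (\<lambda>r. norm (f k r)) (\<bar>\<tau>\<bar> ^ k / fact k * (Gamma (\<beta> * real k + 1) / x powr (\<beta> * real k + 1)))" for k
    unfolding norm_f using \<beta> x by (intro has_bochner_integral_mult_right has_bochner_integral_Gamma) auto
  have tm: "t ^ k / fact k * (Gamma (\<beta> * real k + 1) / x powr (\<beta> * real k + 1)) =
      Gamma (\<beta> * real k + 1) / fact k * (t / x powr \<beta>) ^ k / x" for t k
    using x by (simp add: powr_add powr_powr[symmetric] powr_realpow power_divide mult_ac)
  have sums_f: "(\<lambda>k. f k r) sums (indicator {0<..} r * (exp (- x * r) * exp (- \<tau> * r powr \<beta>)))" for r
  proof (cases "r > 0")
    case True
    have "f k r = exp (- x * r) * ((- \<tau> * r powr \<beta>) ^ k /\<^sub>R fact k)" for k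
      using True
      by (subst power_mult_distrib) (simp add: f_def powr_powr[symmetric] powr_realpow divide_inverse)
    moreover have "(\<lambda>k. exp (- x * r) * ((- \<tau> * r powr \<beta>) ^ k /\<^sub>R fact k)) sums (exp (- x * r) * exp (- \<tau> * r powr \<beta>))"
      by (intro sums_mult exp_converges)
    ultimately show ?thesis using True by simp
  qed (auto simp: f_def)
  have sum_norm: "summable (\<lambda>k. norm (f k r))" for r
  proof (cases "r > 0")
    case True
    have "norm (f k r) = exp (- x * r) * (norm (\<bar>\<tau>\<bar> * r powr \<beta>) ^ k /\<^sub>R fact k)" for k
      unfolding norm_f using True
      by (simp add: powr_powr[symmetric] powr_realpow power_mult_distrib abs_mult field_simps)
    thus ?thesis by (simp only:) (intro summable_mult summable_exp_generic)
  qed (auto simp: f_def)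
  have "(\<integral>r. (\<Sum>k. f k r) \<partial>lborel) = (\<Sum>k. integral\<^sup>L lborel (f k))"
  proof (rule integral_suminf)
    show "integrable lborel (f k)" for k using * by (auto simp: has_bochner_integral_iff)
    show "summable (\<lambda>k. \<integral>r. norm (f k r) \<partial>lborel)"
      unfolding has_bochner_integral_integral_eq[OF **] tm
      using summable_Gamma_fact[OF \<beta>, of "\<bar>\<tau>\<bar> / x powr \<beta>"] by (intro summable_divide) simp
  qed (use sum_norm in auto)
  also have "(\<lambda>r. (\<Sum>k. f k r)) = (\<lambda>r. indicator {0<..} r * (exp (- x * r) * exp (- \<tau> * r powr \<beta>)))"
    using sums_f by (simp add: sums_iff fun_eq_iff)
  also have "(\<Sum>k. integral\<^sup>L lborel (f k)) = (\<Sum>k. Gamma (\<beta> * real k + 1) / fact k * (- \<tau> / x powr \<beta>) ^ k / x)"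
    unfolding has_bochner_integral_integral_eq[OF *] tm ..
  also have "\<dots> = (\<Sum>k. Gamma (\<beta> * real k + 1) / fact k * (- \<tau> / x powr \<beta>) ^ k) / x"
    using summable_Gamma_fact[OF \<beta>, of "- \<tau> / x powr \<beta>"] by (intro suminf_divide) auto
  finally show ?thesis .
qed

text \<open>By the preceding lemma, the Laplace transform of \<open>r \<mapsto> exp (- \<tau> * r powr \<beta>)\<close> at \<open>x\<close> is
  \<open>stable_series \<beta> (- \<tau> / x powr \<beta>) / x\<close>. Being a power series in \<open>x powr (- \<beta>)\<close>, this form makes
  sense for complex \<open>x\<close> off the negative axis.\<close>

definition stable_series :: "real \<Rightarrow> 'a \<Rightarrow> 'a::{real_normed_field,banach}" where
  "stable_series \<beta> z = (\<Sum>k. of_real (Gamma (\<beta> * real k + 1) / fact k) * z ^ k)"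

text \<open>This series is needed for a primitive of \<open>x \<mapsto> stable_series \<beta> (- \<tau> / x powr \<beta>) / x\<close>. The library has
  \<open>Gamma 0 = 0\<close>, so the sum effectively starts at \<open>k = 1\<close>.\<close>

definition stable_log_series :: "real \<Rightarrow> 'a \<Rightarrow> 'a::{real_normed_field,banach}" where
  "stable_log_series \<beta> z = (\<Sum>k. of_real (Gamma (\<beta> * real k) / fact k) * z ^ k)"

lemma summable_Gamma_fact_log:
  fixes z :: "'a :: {real_normed_field, banach}"
  assumes "0 < \<beta>" "\<beta> < 1"
  shows "summable (\<lambda>k. of_real (Gamma (\<beta> * real k) / fact k) * z ^ k)"
proof (rule summable_comparison_test')
  have "summable (\<lambda>k. of_real (Gamma (\<beta> * real k + 1) / fact k) * norm z ^ k)"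
    by (rule summable_Gamma_fact[OF assms])
  from summable_mult[OF this, of "1 / \<beta>"]
  show "summable (\<lambda>k. Gamma (\<beta> * real k + 1) / fact k * norm z ^ k / \<beta>)"
    using assms by (simp add: mult.commute)
  fix k :: nat assume "k \<ge> 0"
  show "norm (of_real (Gamma (\<beta> * real k) / fact k) * z ^ k) \<le> Gamma (\<beta> * real k + 1) / fact k * norm z ^ k / \<beta>"
  proof (cases "k = 0")
    case False
    hence pos: "\<beta> * real k > 0" using assms by simp
    have "Gamma (\<beta> * real k + 1) = \<beta> * real k * Gamma (\<beta> * real k)"
      using pos by (rule Gamma_real_plus1)
    moreover have "1 * Gamma (\<beta> * real k) \<le> real k * Gamma (\<beta> * real k)"
      using Gamma_real_pos[OF pos] False by (intro mult_right_mono) auto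
    ultimately have "Gamma (\<beta> * real k) \<le> Gamma (\<beta> * real k + 1) / \<beta>"
      using assms by (simp add: field_simps)
    hence "Gamma (\<beta> * real k) / fact k * norm z ^ k \<le> Gamma (\<beta> * real k + 1) / \<beta> / fact k * norm z ^ k"
      by (intro mult_right_mono divide_right_mono) auto
    thus ?thesis using Gamma_real_pos[OF pos] by (simp add: norm_mult norm_power norm_divide field_simps)
  qed (use assms in auto)
qed

lemma has_field_derivative_stable_log_series:
  fixes z :: "'a :: {real_normed_field, banach}"
  assumes \<beta>: "0 < \<beta>" "\<beta> < 1"
  obtains D where "(stable_log_series \<beta> has_field_derivative D) (at z)" 
    "of_real \<beta> * z * D = stable_series \<beta> z - 1"
proof
  let ?b = "\<lambda>k. of_real (Gamma (\<beta> * real k) / fact k) :: 'a"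
  let ?c = "\<lambda>k. of_real (Gamma (\<beta> * real k + 1) / fact k) :: 'a"
  show "(stable_log_series \<beta> has_field_derivative (\<Sum>k. diffs ?b k * z ^ k)) (at z)"
    unfolding stable_log_series_def
    by (rule termdiffs_strong_converges_everywhere summable_Gamma_fact_log \<beta>)+
  have sm: "summable (\<lambda>k. diffs ?b k * z ^ k)"
    by (intro termdiff_converges_all summable_Gamma_fact_log \<beta>)
  have "of_real \<beta> * z * (\<Sum>k. diffs ?b k * z ^ k) = (\<Sum>k. of_real \<beta> * z * (diffs ?b k * z ^ k))"
    using sm by (rule suminf_mult[symmetric])
  also have "\<dots> = (\<Sum>k. ?c (Suc k) * z ^ Suc k)"
  proof (intro suminf_cong)
    fix k
    have "Gamma (\<beta> * real (Suc k) + 1) = \<beta> * real (Suc k) * Gamma (\<beta> * real (Suc k))"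
      using \<beta> by (intro Gamma_real_plus1) simp
    thus "of_real \<beta> * z * (diffs ?b k * z ^ k) = ?c (Suc k) * z ^ Suc k"
      by (simp add: diffs_def mult_ac del: of_nat_Suc fact_Suc)
  qed
  also have "\<dots> = stable_series \<beta> z - 1"
    using suminf_split_head[OF summable_Gamma_fact[OF \<beta>, of z]] by (simp add: stable_series_def)
  finally show "of_real \<beta> * z * (\<Sum>k. diffs ?b k * z ^ k) = stable_series \<beta> z - 1" .
qed

lemma stable_series_of_real:
  assumes "0 < \<beta>" "\<beta> < 1"
  shows "stable_series \<beta> (of_real x :: complex) = of_real (stable_series \<beta> x)"
  unfolding stable_series_def using summable_Gamma_fact[OF assms, of x]
  by (subst suminf_of_real) auto

lemma holomorphic_on_stable_series:
  assumes "0 < \<beta>" "\<beta> < 1" "f holomorphic_on S"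
  shows "(\<lambda>z. stable_series \<beta> (f z)) holomorphic_on S"
proof -
  have "(stable_series \<beta> has_field_derivative (\<Sum>k. diffs (\<lambda>k. of_real (Gamma (\<beta> * real k + 1) / fact k)) k * z ^ k)) (at z)" for z :: complex
    unfolding stable_series_def
    by (rule termdiffs_strong_converges_everywhere summable_Gamma_fact assms)+
  hence "stable_series \<beta> holomorphic_on (UNIV :: complex set)"
    by (auto simp: holomorphic_on_def field_differentiable_def intro: has_field_derivative_at_within)
  from holomorphic_on_compose_gen[OF assms(3) this] show ?thesis by (simp add: o_def)
qed

section \<open>The Stieltjes transform of a stable law\<close>

text \<open>The laws on the half-line whose Laplace transform is that of a \<open>\<beta>\<close>-stable subordinator at
  time \<open>\<tau>\<close>.\<close>

definition stable_law :: "real \<Rightarrow> real \<Rightarrow> real measure \<Rightarrow> bool" where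
  "stable_law \<beta> \<tau> \<nu> \<longleftrightarrow> real_distribution \<nu> \<and> (AE s in \<nu>. 0 \<le> s) \<and>
     (\<forall>\<xi>\<ge>0. (\<integral>s. exp (- \<xi> * s) \<partial>\<nu>) = exp (- \<tau> * \<xi> powr \<beta>))"

text \<open>Since \<open>1 / (x + s)\<close> is the Laplace transform of \<open>r \<mapsto> exp (- s * r)\<close>, the Stieltjes transform is an
  iterated Laplace transform. The cut-off \<open>max s 0\<close> equals \<open>s\<close> almost surely and keeps the
  denominator away from zero for every \<open>s\<close>.\<close>

lemma stieltjes_real:
  assumes \<beta>: "0 < \<beta>" "\<beta> < 1" and \<nu>: "stable_law \<beta> \<tau> \<nu>" and x: "0 < x"
  shows "(\<integral>s. 1 / (x + max s 0) \<partial>\<nu>) = stable_series \<beta> (- \<tau> / x powr \<beta>) / x"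
proof -
  interpret real_distribution \<nu> using \<nu> by (simp add: stable_law_def)
  interpret pair_sigma_finite \<nu> lborel ..
  define f :: "real \<Rightarrow> real \<Rightarrow> real"
    where "f = (\<lambda>s r. indicator {0<..} r * (exp (- x * r) * exp (- r * max s 0)))"
  have f: "has_bochner_integral lborel (f s) (1 / (x + max s 0))" for s
  proof -
    have "f s = (\<lambda>r. indicator {0<..} r * (r powr 0 * exp (- (x + max s 0) * r)))"
      by (auto simp: f_def fun_eq_iff indicator_def algebra_simps simp flip: exp_add)
    with has_bochner_integral_Gamma[of 0 "x + max s 0"] x show ?thesis by simp
  qed
  have nf: "norm (f s r) = f s r" for s r by (simp add: f_def)
  have fm[measurable]: "case_prod f \<in> borel_measurable (\<nu> \<Otimes>\<^sub>M lborel)"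
    unfolding f_def by measurable
  have int: "integrable (\<nu> \<Otimes>\<^sub>M lborel) (case_prod f)"
  proof (rule Fubini_integrable)
    show "integrable \<nu> (\<lambda>s. \<integral>r. norm (case_prod f (s, r)) \<partial>lborel)"
      unfolding case_prod_conv nf has_bochner_integral_integral_eq[OF f]
      using x by (intro integrable_const_bound[of _ "1/x"] always_eventually allI) (auto intro!: frac_le)
  qed (use f in \<open>auto simp: has_bochner_integral_iff\<close>)
  have "(\<integral>s. 1 / (x + max s 0) \<partial>\<nu>) = (\<integral>s. (\<integral>r. f s r \<partial>lborel) \<partial>\<nu>)"
    by (simp add: has_bochner_integral_integral_eq[OF f])
  also have "\<dots> = (\<integral>r. (\<integral>s. f s r \<partial>\<nu>) \<partial>lborel)"
    using Fubini_integral[OF int] by simp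
  also have "\<dots> = (\<integral>r. indicator {0<..} r * (exp (- x * r) * exp (- \<tau> * r powr \<beta>)) \<partial>lborel)"
  proof (intro Bochner_Integration.integral_cong refl)
    fix r :: real
    have "(\<integral>s. exp (- r * max s 0) \<partial>\<nu>) = (\<integral>s. exp (- r * s) \<partial>\<nu>)"
    proof (rule integral_cong_AE)
      have "AE s in \<nu>. 0 \<le> s" using \<nu> by (simp add: stable_law_def)
      thus "AE s in \<nu>. exp (- r * max s 0) = exp (- r * s)" by (rule eventually_mono) auto
    qed auto
    thus "(\<integral>s. f s r \<partial>\<nu>) = indicator {0<..} r * (exp (- x * r) * exp (- \<tau> * r powr \<beta>))"
      using \<nu> by (simp add: f_def stable_law_def indicator_def)
  qed
  also have "\<dots> = stable_series \<beta> (- \<tau> / x powr \<beta>) / x"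
    using laplace_exp_powr[OF \<beta> x] by (simp add: stable_series_def)
  finally show ?thesis .
qed

abbreviation slit_plane :: "complex set" where "slit_plane \<equiv> - \<real>\<^sub>\<le>\<^sub>0"

lemma open_slit_plane: "open slit_plane"
  by (simp add: open_Compl)

lemma nonpos_Reals_eq_image: "\<real>\<^sub>\<le>\<^sub>0 = complex_of_real ` {..0}"
  by (auto simp: complex_nonpos_Reals_iff complex_eq_iff image_iff intro!: bexI[of _ "Re _"])

lemma connected_slit_plane: "connected slit_plane"
  unfolding nonpos_Reals_eq_image by (intro starlike_imp_connected starlike_slotted_complex_plane_left)

text \<open>On a ball of radius \<open>r\<close> that avoids the negative axis, \<open>1 / (w + h)\<close> is a geometric series in
  \<open>w - z\<close>, uniformly in \<open>h \<ge> 0\<close>; it may be integrated term by term.\<close>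

lemma holomorphic_stieltjes:
  assumes "real_distribution \<nu>"
  shows "(\<lambda>w. \<integral>s. 1 / (w + of_real (max s 0)) \<partial>\<nu>) holomorphic_on slit_plane"
proof -
  interpret real_distribution \<nu> by fact
  have "\<exists>r>0. (\<lambda>w. \<integral>s. 1 / (w + of_real (max s 0)) \<partial>\<nu>) holomorphic_on ball z r" if "z \<in> slit_plane" for z
  proof -
    from that open_slit_plane obtain r where r: "r > 0" "ball z r \<subseteq> slit_plane"
      unfolding open_contains_ball by blast
    have far: "r \<le> cmod (z + of_real (max s 0))" for s
    proof (rule ccontr)
      assume "\<not> r \<le> cmod (z + of_real (max s 0))"
      hence "- of_real (max s 0) \<in> ball z r"
        by (simp add: dist_norm)
      with r(2) have "- complex_of_real (max s 0) \<notin> \<real>\<^sub>\<le>\<^sub>0" by blast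
      thus False by (auto simp: complex_nonpos_Reals_iff)
    qed
    have "((\<lambda>n. (\<integral>s. (-1) ^ n / (z + of_real (max s 0)) ^ Suc n \<partial>\<nu>) * (w - z) ^ n) sums
             (\<integral>s. 1 / (w + of_real (max s 0)) \<partial>\<nu>))" if w: "w \<in> ball z r" for w
    proof -
      \<comment> \<open>the ratio of the dominating geometric series\<close>
      define q where "q = cmod (w - z) / r"
      have q: "0 \<le> q" "q < 1" using w r by (auto simp: q_def dist_norm norm_minus_commute)
      define f where "f = (\<lambda>n s. (- (w - z) / (z + of_real (max s 0))) ^ n / (z + of_real (max s 0)))"
      have [measurable]: "f n \<in> borel_measurable \<nu>" for n unfolding f_def by measurable
      have f_le: "norm (f n s) \<le> q ^ n / r" for n s
      proof -
        have "norm (f n s) = (cmod (w - z) / cmod (z + of_real (max s 0))) ^ n / cmod (z + of_real (max s 0))"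
          by (simp add: f_def norm_divide norm_power norm_minus_commute)
        also have "\<dots> \<le> (cmod (w - z) / r) ^ n / r"
          using far[of s] r by (intro frac_le power_mono divide_left_mono) auto
        finally show ?thesis by (simp add: q_def)
      qed
      have sm: "summable (\<lambda>n. q ^ n / r)"
        using q by (intro summable_divide summable_geometric) auto
      have f_sums: "(\<lambda>n. f n s) sums (1 / (w + of_real (max s 0)))" for s
      proof -
        let ?h = "z + of_real (max s 0)"
        have nz: "?h \<noteq> 0" using far[of s] r by auto
        have "cmod (w - z) < cmod ?h" using far[of s] w by (simp add: dist_norm norm_minus_commute)
        hence "norm (- (w - z) / ?h) < 1" using nz by (simp add: norm_divide norm_minus_commute)
        hence "(\<lambda>n. (- (w - z) / ?h) ^ n / ?h) sums (1 / (1 - (- (w - z) / ?h)) / ?h)"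
          by (intro sums_divide geometric_sums)
        also have "1 - (- (w - z) / ?h) = (w + of_real (max s 0)) / ?h"
          using nz by (simp add: field_simps)
        also have "1 / ((w + of_real (max s 0)) / ?h) / ?h = 1 / (w + of_real (max s 0))"
          using nz by simp
        finally show ?thesis by (simp add: f_def)
      qed
      have int: "integrable \<nu> (f n)" for n
        using f_le by (intro integrable_const_bound[of _ "q ^ n / r"]) auto
      have "(\<lambda>n. \<integral>s. f n s \<partial>\<nu>) sums (\<integral>s. (\<Sum>n. f n s) \<partial>\<nu>)"
      proof (rule sums_integral[OF int])
        show "AE s in \<nu>. summable (\<lambda>n. norm (f n s))"
          by (intro always_eventually allI summable_comparison_test'[OF sm, of 0]) (use f_le in auto)
        show "summable (\<lambda>n. \<integral>s. norm (f n s) \<partial>\<nu>)"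
        proof (rule summable_comparison_test'[OF sm, of 0])
          fix n
          have "(\<integral>s. norm (f n s) \<partial>\<nu>) \<le> (\<integral>s. q ^ n / r \<partial>\<nu>)"
            using int f_le by (intro integral_mono) auto
          thus "norm (\<integral>s. norm (f n s) \<partial>\<nu>) \<le> q ^ n / r" using prob_space by simp
        qed
      qed
      also have "(\<lambda>n. \<integral>s. f n s \<partial>\<nu>) = (\<lambda>n. (\<integral>s. (-1) ^ n / (z + of_real (max s 0)) ^ Suc n \<partial>\<nu>) * (w - z) ^ n)"
        unfolding f_def
        by (subst integral_mult_left_zero[symmetric], intro ext Bochner_Integration.integral_cong refl)
           (simp add: power_divide power_mult_distrib[symmetric] mult_ac)
      also have "(\<lambda>s. \<Sum>n. f n s) = (\<lambda>s. 1 / (w + of_real (max s 0)))"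
        using f_sums by (simp add: sums_iff)
      finally show ?thesis .
    qed
    hence "(\<lambda>w. \<integral>s. 1 / (w + of_real (max s 0)) \<partial>\<nu>) holomorphic_on ball z r"
      by (rule power_series_holomorphic)
    with r show ?thesis by blast
  qed
  thus ?thesis
    by (intro analytic_imp_holomorphic) (auto simp: analytic_on_def)
qed

text \<open>The principal branch of \<open>- \<tau> / w powr \<beta>\<close> off the negative axis.\<close>

definition frac_pow_arg :: "real \<Rightarrow> real \<Rightarrow> complex \<Rightarrow> complex" where
  "frac_pow_arg \<beta> \<tau> w = - of_real \<tau> * exp (- of_real \<beta> * Ln w)"

lemma frac_pow_arg_of_real:
  "x > 0 \<Longrightarrow> frac_pow_arg \<beta> \<tau> (of_real x) = of_real (- \<tau> / x powr \<beta>)"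
  by (simp add: frac_pow_arg_def Ln_of_real powr_def exp_minus field_simps flip: exp_of_real)

text \<open>Both sides are holomorphic and they agree on the positive axis. This continuation is what allows the
  transform to be evaluated close to the negative axis, where it determines the law.\<close>

lemma stieltjes_slit_plane:
  assumes \<beta>: "0 < \<beta>" "\<beta> < 1" and \<nu>: "stable_law \<beta> \<tau> \<nu>" and w: "w \<in> slit_plane"
  shows "(\<integral>s. 1 / (w + of_real (max s 0)) \<partial>\<nu>) = stable_series \<beta> (frac_pow_arg \<beta> \<tau> w) / w"
proof -
  interpret real_distribution \<nu> using \<nu> by (simp add: stable_law_def)
  let ?F = "\<lambda>w. (\<integral>s. 1 / (w + of_real (max s 0)) \<partial>\<nu>)"
  let ?G = "\<lambda>w. stable_series \<beta> (frac_pow_arg \<beta> \<tau> w) / w"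
  have "?F w - ?G w = 0"
  proof (rule analytic_continuation[where f = "\<lambda>w. ?F w - ?G w" and \<xi> = 1 and U = "of_real ` {0<..}", OF _ open_slit_plane connected_slit_plane])
    have "?G holomorphic_on slit_plane"
      unfolding frac_pow_arg_def
      by (intro holomorphic_intros holomorphic_on_stable_series \<beta>) auto
    thus "(\<lambda>w. ?F w - ?G w) holomorphic_on slit_plane"
      by (intro holomorphic_on_diff holomorphic_stieltjes real_distribution_axioms)
    show "of_real ` {0<..} \<subseteq> slit_plane" by (auto simp: complex_nonpos_Reals_iff)
    show "(1::complex) \<in> slit_plane" by simp
    show "(1::complex) islimpt (of_real ` {0<..})"
      unfolding islimpt_sequential
    proof (intro exI[of _ "\<lambda>n. of_real (1 + 1 / real (Suc n))"] conjI allI)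
      have "(\<lambda>n. 1 + 1 / real (Suc n)) \<longlonglongrightarrow> 1" by real_asymp
      hence "(\<lambda>n. complex_of_real (1 + 1 / real (Suc n))) \<longlonglongrightarrow> of_real 1" by (rule tendsto_of_real)
      thus "(\<lambda>n. complex_of_real (1 + 1 / real (Suc n))) \<longlonglongrightarrow> 1" by simp
      fix n show "complex_of_real (1 + 1 / real (Suc n)) \<in> of_real ` {0<..} - {1}"
        by (auto simp: complex_eq_iff add_pos_pos)
    qed
    fix z :: complex assume "z \<in> of_real ` {0<..}"
    then obtain x where x: "z = of_real x" "x > 0" by auto
    have "?F z = of_real (\<integral>s. 1 / (x + max s 0) \<partial>\<nu>)"
      unfolding x by (subst integral_complex_of_real[symmetric]) simp
    also have "\<dots> = of_real (stable_series \<beta> (- \<tau> / x powr \<beta>) / x)"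
      using stieltjes_real[OF \<beta> \<nu> x(2)] by simp
    also have "\<dots> = ?G z"
      unfolding x frac_pow_arg_of_real[OF x(2)] stable_series_of_real[OF \<beta>] by simp
    finally show "?F z - ?G z = 0" by simp
  qed fact
  thus ?thesis by simp
qed

section \<open>Integration of the Stieltjes transform\<close>

lemma slit_plane_add_nonneg:
  assumes "z \<in> slit_plane" "0 \<le> h"
  shows "z + of_real h \<in> slit_plane"
  using assms by (auto simp: complex_nonpos_Reals_iff)

text \<open>The slit plane is star-shaped about 1, so primitives can be computed along segments from 1.\<close>

lemma segment_from_1_in_slit_plane:
  assumes "w \<in> slit_plane" "0 \<le> u" "u \<le> 1"
  shows "1 + of_real u * (w - 1) \<in> slit_plane"
proof
  assume "1 + of_real u * (w - 1) \<in> \<real>\<^sub>\<le>\<^sub>0"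
  hence *: "1 + u * (Re w - 1) \<le> 0" "u * Im w = 0"
    by (auto simp: complex_nonpos_Reals_iff)
  have "u \<noteq> 0" using * by auto
  hence "Im w = 0" using * by auto
  hence "Re w > 0" using assms(1) by (auto simp: complex_nonpos_Reals_iff)
  hence "u * Re w > 0" using \<open>u \<noteq> 0\<close> assms by auto
  thus False using * assms by (auto simp: algebra_simps)
qed

lemma integral_segment_from_1:
  assumes F: "\<And>z. z \<in> slit_plane \<Longrightarrow> (F has_field_derivative f z) (at z)"
    and f: "continuous_on slit_plane f" and w: "w \<in> slit_plane"
  shows "has_bochner_integral lborel
           (\<lambda>u. indicator {0..1} u *\<^sub>R (f (1 + of_real u * (w - 1)) * (w - 1))) (F w - F 1)"
proof -
  let ?\<gamma> = "\<lambda>u::real. 1 + of_real u * (w - 1)"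
  have "has_bochner_integral lborel (\<lambda>u. indicator {0..1} u *\<^sub>R (f (?\<gamma> u) * (w - 1))) (F (?\<gamma> 1) - F (?\<gamma> 0))"
  proof (rule has_bochner_integral_FTC_Icc)
    fix u :: real assume u: "0 \<le> u" "u \<le> 1"
    have "(?\<gamma> has_vector_derivative (w - 1)) (at u within {0..1})"
      by (auto intro!: derivative_eq_intros has_vector_derivative_of_real)
    from field_vector_diff_chain_within[OF this, of F "f (?\<gamma> u)"] F[OF segment_from_1_in_slit_plane[OF w u]]
    show "((\<lambda>u. F (?\<gamma> u)) has_vector_derivative (f (?\<gamma> u) * (w - 1))) (at u within {0..1})"
      by (auto simp: o_def mult.commute intro: has_field_derivative_at_within)
  next
    show "continuous_on {0..1} (\<lambda>u. f (?\<gamma> u) * (w - 1))"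
      using segment_from_1_in_slit_plane[OF w]
      by (intro continuous_intros continuous_on_compose2[OF f]) auto
  qed auto
  thus ?thesis by simp
qed

text \<open>A primitive of the Stieltjes transform; the logarithm comes from the term \<open>k = 0\<close> of
  \<open>stable_series\<close>.\<close>

definition log_stieltjes :: "real \<Rightarrow> real \<Rightarrow> complex \<Rightarrow> complex" where
  "log_stieltjes \<beta> \<tau> w = Ln w - stable_log_series \<beta> (frac_pow_arg \<beta> \<tau> w)"

lemma has_field_derivative_log_stieltjes:
  assumes \<beta>: "0 < \<beta>" "\<beta> < 1" and w: "w \<in> slit_plane"
  shows "(log_stieltjes \<beta> \<tau> has_field_derivative stable_series \<beta> (frac_pow_arg \<beta> \<tau> w) / w) (at w)"
proof -
  let ?\<zeta> = "frac_pow_arg \<beta> \<tau> w"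
  obtain D where D: "(stable_log_series \<beta> has_field_derivative D) (at ?\<zeta>)" 
    "of_real \<beta> * ?\<zeta> * D = stable_series \<beta> ?\<zeta> - 1"
    by (rule has_field_derivative_stable_log_series[OF \<beta>])
  have w0: "w \<noteq> 0" using w by auto
  have "(frac_pow_arg \<beta> \<tau> has_field_derivative ?\<zeta> * (- of_real \<beta> / w)) (at w)"
    unfolding frac_pow_arg_def using w by (auto intro!: derivative_eq_intros simp: field_simps)
  from DERIV_chain[OF D(1) this]
  have "((\<lambda>w. Ln w - stable_log_series \<beta> (frac_pow_arg \<beta> \<tau> w)) has_field_derivative 
          (1 / w - D * (?\<zeta> * (- of_real \<beta> / w)))) (at w)"
    using w by (auto intro!: derivative_eq_intros simp: o_def inverse_eq_divide)
  also have "1 / w - D * (?\<zeta> * (- of_real \<beta> / w)) = (1 + of_real \<beta> * ?\<zeta> * D) / w"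
    using w0 by (simp add: field_simps)
  finally show ?thesis unfolding D(2) log_stieltjes_def[abs_def] by simp
qed

text \<open>Integrating the Stieltjes transform from 1 to \<open>w\<close> and exchanging the integrals yields the expectation
  of \<open>Ln (w + s) - Ln (1 + s)\<close>. Only the imaginary part is kept: it is bounded, and it vanishes
  at the end point 1.\<close>

lemma expectation_Im_Ln:
  assumes \<beta>: "0 < \<beta>" "\<beta> < 1" and \<nu>: "stable_law \<beta> \<tau> \<nu>" and w: "w \<in> slit_plane"
  shows "(\<integral>s. Im (Ln (w + of_real (max s 0))) \<partial>\<nu>) = Im (log_stieltjes \<beta> \<tau> w)"
proof -
  interpret real_distribution \<nu> using \<nu> by (simp add: stable_law_def)
  interpret pair_sigma_finite \<nu> lborel ..
  let ?\<gamma> = "\<lambda>u::real. 1 + of_real u * (w - 1)"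
  have \<gamma>: "?\<gamma> u \<in> slit_plane" if "0 \<le> u" "u \<le> 1" for u
    by (rule segment_from_1_in_slit_plane) (use w that in auto)
  define f :: "real \<Rightarrow> real \<Rightarrow> complex"
    where "f = (\<lambda>s u. indicator {0..1} u *\<^sub>R (1 / (?\<gamma> u + of_real (max s 0)) * (w - 1)))"
  have f: "has_bochner_integral lborel (f s) (Ln (w + of_real (max s 0)) - Ln (1 + of_real (max s 0)))" for s
    unfolding f_def
  proof (rule integral_segment_from_1[where F = "\<lambda>z. Ln (z + of_real (max s 0))" and f = "\<lambda>z. 1 / (z + of_real (max s 0))"])
    fix z assume "z \<in> slit_plane"
    hence "z + of_real (max s 0) \<in> slit_plane" by (rule slit_plane_add_nonneg) auto
    thus "((\<lambda>z. Ln (z + of_real (max s 0))) has_field_derivative 1 / (z + of_real (max s 0))) (at z)"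
      by (auto intro!: derivative_eq_intros simp: inverse_eq_divide)
  next
    have "z + of_real (max s 0) \<noteq> 0" if "z \<in> slit_plane" for z
      using slit_plane_add_nonneg[OF that, of "max s 0"] by auto
    thus "continuous_on slit_plane (\<lambda>z. 1 / (z + of_real (max s 0)))"
      by (auto intro!: continuous_intros)
  qed fact
  \<comment> \<open>the segment is compact, hence at positive distance from the negative axis\<close>
  obtain d where d: "d > 0" "\<And>u s. u \<in> {0..1} \<Longrightarrow> d \<le> cmod (?\<gamma> u + of_real (max s 0))"
  proof -
    have "compact (?\<gamma> ` {0..1})"
      by (intro compact_continuous_image continuous_intros) auto
    moreover have "?\<gamma> ` {0..1} \<inter> \<real>\<^sub>\<le>\<^sub>0 = {}" using \<gamma> by auto
    ultimately have "\<exists>d>0. \<forall>x\<in>?\<gamma> ` {0..1}. \<forall>y\<in>\<real>\<^sub>\<le>\<^sub>0. d \<le> dist x y"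
      by (intro separate_compact_closed) auto
    then obtain d where d: "d > 0" "\<And>u y. u \<in> {0..1} \<Longrightarrow> y \<in> \<real>\<^sub>\<le>\<^sub>0 \<Longrightarrow> d \<le> dist (?\<gamma> u) y" by blast
    have "- complex_of_real (max s 0) \<in> \<real>\<^sub>\<le>\<^sub>0" for s by (auto simp: complex_nonpos_Reals_iff)
    from d(2)[OF _ this] have "d \<le> cmod (?\<gamma> u + of_real (max s 0))" if "u \<in> {0..1}" for u s
      using that by (simp add: dist_norm)
    with d(1) show ?thesis using that by blast
  qed
  have nf: "norm (f s u) \<le> indicator {0..1} u * (cmod (w - 1) / d)" for s u
    using d by (auto simp: f_def indicator_def norm_divide intro!: frac_le)
  have [measurable]: "case_prod f \<in> borel_measurable (\<nu> \<Otimes>\<^sub>M lborel)"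
    unfolding f_def by measurable
  have [measurable]: "f s \<in> borel_measurable lborel" for s
    unfolding f_def by measurable
  have int: "integrable (\<nu> \<Otimes>\<^sub>M lborel) (case_prod f)"
  proof (rule Fubini_integrable)
    show "integrable \<nu> (\<lambda>s. \<integral>u. norm (case_prod f (s, u)) \<partial>lborel)"
    proof (rule integrable_const_bound)
      show "AE s in \<nu>. norm (\<integral>u. norm (case_prod f (s, u)) \<partial>lborel) \<le> cmod (w - 1) / d"
      proof (intro always_eventually allI)
        fix s
        have "(\<integral>u. norm (f s u) \<partial>lborel) \<le> (\<integral>u. indicator {0..1::real} u * (cmod (w - 1) / d) \<partial>lborel)"
        proof (rule integral_mono)
          show "integrable lborel (\<lambda>u. norm (f s u))"
            using f[of s] by (auto simp: has_bochner_integral_iff)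
        qed (use nf in auto)
        thus "norm (\<integral>u. norm (case_prod f (s, u)) \<partial>lborel) \<le> cmod (w - 1) / d" by simp
      qed
    qed measurable
  qed (use f in \<open>auto simp: has_bochner_integral_iff\<close>)
  have "(\<integral>s. (\<integral>u. f s u \<partial>lborel) \<partial>\<nu>) = (\<integral>u. (\<integral>s. f s u \<partial>\<nu>) \<partial>lborel)"
    using Fubini_integral[OF int] by simp
  also have "\<dots> = (\<integral>u. indicator {0..1} u *\<^sub>R (stable_series \<beta> (frac_pow_arg \<beta> \<tau> (?\<gamma> u)) / ?\<gamma> u * (w - 1)) \<partial>lborel)"
  proof (intro Bochner_Integration.integral_cong refl)
    fix u :: real
    show "(\<integral>s. f s u \<partial>\<nu>) = indicator {0..1} u *\<^sub>R (stable_series \<beta> (frac_pow_arg \<beta> \<tau> (?\<gamma> u)) / ?\<gamma> u * (w - 1))"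
    proof (cases "u \<in> {0..1}")
      case True
      hence "(\<integral>s. f s u \<partial>\<nu>) = (\<integral>s. 1 / (?\<gamma> u + of_real (max s 0)) * (w - 1) \<partial>\<nu>)"
        by (simp add: f_def)
      also have "\<dots> = (\<integral>s. 1 / (?\<gamma> u + of_real (max s 0)) \<partial>\<nu>) * (w - 1)"
        by (rule integral_mult_left_zero)
      finally show ?thesis
        using True stieltjes_slit_plane[OF \<beta> \<nu> \<gamma>[of u]] by simp
    qed (simp add: f_def)
  qed
  also have "\<dots> = log_stieltjes \<beta> \<tau> w - log_stieltjes \<beta> \<tau> 1"
  proof (intro has_bochner_integral_integral_eq integral_segment_from_1)
    show "continuous_on slit_plane (\<lambda>z. stable_series \<beta> (frac_pow_arg \<beta> \<tau> z) / z)"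
      unfolding frac_pow_arg_def
      by (intro holomorphic_on_imp_continuous_on holomorphic_intros holomorphic_on_stable_series \<beta>) auto
  qed (use has_field_derivative_log_stieltjes[OF \<beta>] w in auto)
  finally have "(\<integral>s. Ln (w + of_real (max s 0)) - Ln (1 + of_real (max s 0)) \<partial>\<nu>) = log_stieltjes \<beta> \<tau> w - log_stieltjes \<beta> \<tau> 1"
    by (simp add: has_bochner_integral_integral_eq[OF f])
  moreover have "integrable \<nu> (\<lambda>s. Ln (w + of_real (max s 0)) - Ln (1 + of_real (max s 0)))"
    using integrable_fst[OF int] by (simp add: has_bochner_integral_integral_eq[OF f])
  ultimately have "(\<integral>s. Im (Ln (w + of_real (max s 0)) - Ln (1 + of_real (max s 0))) \<partial>\<nu>) = Im (log_stieltjes \<beta> \<tau> w - log_stieltjes \<beta> \<tau> 1)"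
    by (subst integral_Im) auto
  moreover have "Im (Ln (1 + of_real (max s 0))) = 0" for s
    using Ln_of_real[of "1 + max s 0"] by (simp add: add_pos_nonneg)
  moreover have "Im (log_stieltjes \<beta> \<tau> 1) = 0"
  proof -
    have "stable_log_series \<beta> (complex_of_real (-\<tau>)) = of_real (stable_log_series \<beta> (-\<tau>))"
      unfolding stable_log_series_def using summable_Gamma_fact_log[OF \<beta>, of "-\<tau>"]
      by (subst suminf_of_real) auto
    thus ?thesis by (simp add: log_stieltjes_def frac_pow_arg_def)
  qed
  ultimately show ?thesis by simp
qed

section \<open>Derivatives of the Wright function and boundary values\<close>

lemma tendsto_Ln_upper_side:
  assumes b: "b > 0" and e: "e \<longlonglongrightarrow> 0" "\<And>n. 0 < e n"
  shows "(\<lambda>n. Ln (Complex (- b) (e n))) \<longlonglongrightarrow> Ln (of_real b) + \<i> * of_real pi"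
proof -
  have "(\<lambda>n. Ln (of_real b - \<i> * of_real (e n)) + \<i> * of_real pi) \<longlonglongrightarrow> Ln (of_real b - \<i> * of_real 0) + \<i> * of_real pi"
    using b e by (intro tendsto_intros) (auto simp: complex_nonpos_Reals_iff)
  moreover have "Ln (Complex (- b) (e n)) = Ln (of_real b - \<i> * of_real (e n)) + \<i> * of_real pi" for n
  proof -
    have eq: "Complex (- b) (e n) = - (of_real b - \<i> * of_real (e n))" by (simp add: complex_eq_iff)
    have "of_real b - \<i> * of_real (e n) \<noteq> 0" using b by (simp add: complex_eq_iff)
    from Ln_minus[OF this] show ?thesis unfolding eq using b e(2)[of n] by auto
  qed
  ultimately show ?thesis by simp
qed

lemma rGamma_one_minus:
  assumes "0 < (x::real)"
  shows "rGamma (1 - x) = Gamma x * sin (pi * x) / pi"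
proof -
  have "sin (of_real pi * of_real x) = complex_of_real (sin (pi * x))"
    using sin_of_real[of "pi * x", where 'a = complex] by simp
  hence "complex_of_real (rGamma x * rGamma (1 - x)) = of_real (sin (pi * x) / pi)"
    using rGamma_reflection_complex[of "of_real x"] by (simp flip: rGamma_complex_of_real)
  hence "rGamma x * rGamma (1 - x) = sin (pi * x) / pi" by (simp only: of_real_eq_iff)
  moreover have "rGamma x = 1 / Gamma x" by (simp add: rGamma_inverse_Gamma inverse_eq_divide)
  ultimately show ?thesis using Gamma_real_pos[OF assms] by (simp add: field_simps)
qed

text \<open>The reflection formula. The case \<open>k = 0\<close> is separate because \<open>Gamma (\<beta> * real k) * sin (pi * \<beta> * real k)\<close>
  has a removable singularity there, where the right-hand side would give 0 instead of 1.\<close>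

lemma wright_coeff_neg_order:
  assumes "0 < \<beta>"
  shows "rGamma (1 - real k * \<beta>) / fact k =
           (if k = 0 then 1 else Gamma (\<beta> * real k) / fact k * sin (pi * \<beta> * real k) / pi)"
proof (cases "k = 0")
  case False
  thus ?thesis using rGamma_one_minus[of "\<beta> * real k"] assms by (simp add: mult_ac)
qed auto

text \<open>The series with index \<open>m + 1\<close> is the formal derivative of the one with index \<open>m\<close>, so only
  \<open>m = 0\<close> calls for an estimate.\<close>

lemma summable_wright_neg_order:
  fixes z :: real
  assumes \<beta>: "0 < \<beta>" "\<beta> < 1"
  shows "summable (\<lambda>k. rGamma (1 - real (m + k) * \<beta>) / fact k * z ^ k)"
proof (induction m arbitrary: z)
  case 0
  show ?case
  proof (rule summable_comparison_test'[of _ 1])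
    show "summable (\<lambda>k. of_real (Gamma (\<beta> * real k) / fact k) * \<bar>z\<bar> ^ k :: real)"
      by (rule summable_Gamma_fact_log[OF \<beta>])
    fix k :: nat assume k: "k \<ge> 1"
    hence pos: "Gamma (\<beta> * real k) > 0" using \<beta> by (intro Gamma_real_pos) auto
    have *: "Gamma (\<beta> * real k) / fact k * \<bar>sin (pi * \<beta> * real k)\<bar> / pi \<le> Gamma (\<beta> * real k) / fact k * 1 / 1"
      using pos pi_gt3 by (intro frac_le mult_left_mono) auto
    thus "norm (rGamma (1 - real (0 + k) * \<beta>) / fact k * z ^ k) \<le> of_real (Gamma (\<beta> * real k) / fact k) * \<bar>z\<bar> ^ k"
      using mult_right_mono[OF *, of "\<bar>z\<bar> ^ k"] k pos unfolding add_0 wright_coeff_neg_order[OF \<beta>(1)]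
      by (simp add: abs_mult power_abs)
  qed
next
  case (Suc m)
  have "diffs (\<lambda>k. rGamma (1 - real (m + k) * \<beta>) / fact k) = (\<lambda>k. rGamma (1 - real (Suc m + k) * \<beta>) / fact k)"
    by (auto simp: diffs_def fun_eq_iff add_ac)
  with termdiff_converges_all[OF Suc] show ?case by metis
qed

lemma wright_neg_order:
  "wright (- \<beta>) (1 - real m * \<beta>) z = (\<Sum>k. rGamma (1 - real (m + k) * \<beta>) / fact k * z ^ k)"
  unfolding wright_def by (intro suminf_cong) (simp add: algebra_simps)

lemma DERIV_wright:
  assumes \<beta>: "0 < \<beta>" "\<beta> < 1"
  shows "(wright (- \<beta>) (1 - real m * \<beta>) has_real_derivative wright (- \<beta>) (1 - real (Suc m) * \<beta>) z) (at z)"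
proof -
  have "diffs (\<lambda>k. rGamma (1 - real (m + k) * \<beta>) / fact k) = (\<lambda>k. rGamma (1 - real (Suc m + k) * \<beta>) / fact k)"
    by (auto simp: diffs_def fun_eq_iff add_ac)
  with termdiffs_strong_converges_everywhere[OF summable_wright_neg_order[OF \<beta>], of m z] show ?thesis
    unfolding wright_neg_order[abs_def] by metis
qed

lemma continuous_on_wright:
  assumes "0 < \<beta>" "\<beta> < 1"
  shows "continuous_on A (wright (- \<beta>) (1 - real m * \<beta>))"
  by (intro continuous_at_imp_continuous_on ballI DERIV_isCont[OF DERIV_wright[OF assms]])

lemma wright_neg_order_at_0 [simp]: "wright (- \<beta>) 1 (0::real) = 1"
  using powser_zero[of "\<lambda>k. rGamma (1 - real k * \<beta>) / fact k"] wright_neg_order[of \<beta> 0 0] by simp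

text \<open>The left-hand side is the imaginary part of the limit of \<open>log_stieltjes\<close> at \<open>- b\<close> from
  above, where \<open>Ln\<close> tends to \<open>ln b + \<i> pi\<close>. The powers of \<open>exp (- \<i> \<beta> pi)\<close> contribute the sines that the
  reflection formula converts into reciprocal Gamma values.\<close>

lemma Im_log_stieltjes_limit:
  assumes \<beta>: "0 < \<beta>" "\<beta> < 1" and b: "0 < b"
  shows "pi - Im (stable_log_series \<beta> (- of_real \<tau> * exp (- of_real \<beta> * (Ln (of_real b) + \<i> * of_real pi))))
         = pi * wright (- \<beta>) 1 (- \<tau> / b powr \<beta>)"
proof -
  let ?y = "- \<tau> / b powr \<beta>"
  let ?z = "- of_real \<tau> * exp (- of_real \<beta> * (Ln (of_real b) + \<i> * of_real pi))"
  have z: "?z = of_real ?y * cis (- \<beta> * pi)"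
    using b by (simp add: Ln_of_real ring_distribs exp_add exp_diff exp_minus powr_def cis_conv_exp field_simps flip: exp_of_real)
  have sm: "summable (\<lambda>k. of_real (Gamma (\<beta> * real k) / fact k) * ?z ^ k)"
    by (rule summable_Gamma_fact_log[OF \<beta>])
  have Im: "Im (of_real (Gamma (\<beta> * real k) / fact k) * ?z ^ k) = - (Gamma (\<beta> * real k) / fact k * sin (pi * \<beta> * real k) * ?y ^ k)" for k
  proof -
    have "of_real (Gamma (\<beta> * real k) / fact k) * ?z ^ k = of_real (Gamma (\<beta> * real k) / fact k * ?y ^ k) * cis (of_nat k * (- \<beta> * pi))"
      unfolding z power_mult_distrib Complex.DeMoivre by (simp only: of_real_mult of_real_power mult.assoc)
    moreover have "Im (complex_of_real r * cis t) = r * sin t" for r t by simp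
    moreover have "of_nat k * (- \<beta> * pi) = - (pi * \<beta> * real k)" by simp
    ultimately show ?thesis by (simp only: sin_minus mult_minus_right mult_ac)
  qed
  have "(\<lambda>k. Im (of_real (Gamma (\<beta> * real k) / fact k) * ?z ^ k)) sums Im (stable_log_series \<beta> ?z)"
    unfolding stable_log_series_def by (rule sums_Im[OF summable_sums[OF sm]])
  from sums_minus[OF this]
  have 1: "(\<lambda>k. Gamma (\<beta> * real k) / fact k * sin (pi * \<beta> * real k) * ?y ^ k) sums (- Im (stable_log_series \<beta> ?z))"
    unfolding Im by simp
  \<comment> \<open>the argument \<open>pi\<close> of \<open>- b\<close> supplies the constant term of the Wright function\<close>
  have "(\<lambda>k. (if k = 0 then pi else 0)) sums pi" by (rule sums_single)
  from sums_add[OF 1 this]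
  have 2: "(\<lambda>k. pi * (rGamma (1 - real k * \<beta>) / fact k * ?y ^ k)) sums (- Im (stable_log_series \<beta> ?z) + pi)"
    by (rule sums_cong[THEN iffD1, rotated]) (simp add: wright_coeff_neg_order[OF \<beta>(1)])
  have "summable (\<lambda>k. rGamma (1 - real (0 + k) * \<beta>) / fact k * ?y ^ k)"
    by (rule summable_wright_neg_order[OF \<beta>])
  hence "(\<lambda>k. rGamma (1 - real k * \<beta>) / fact k * ?y ^ k) sums wright (- \<beta>) 1 ?y"
    using wright_neg_order[of \<beta> 0 ?y] by (simp add: sums_iff)
  from sums_unique2[OF 2 sums_mult[OF this, of pi]] show ?thesis by simp
qed

section \<open>The distribution function of a stable law\<close>

text \<open>Let \<open>w\<close> tend to \<open>- b\<close> from the upper half-plane in \<open>expectation_Im_Ln\<close>. The argument of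
  \<open>w + s\<close> tends to \<open>pi\<close> for \<open>s < b\<close>, to 0 for \<open>s > b\<close>, and to \<open>pi / 2\<close> for \<open>s = b\<close>.\<close>

lemma stable_law_lessThan_plus_half_atom:
  assumes \<beta>: "0 < \<beta>" "\<beta> < 1" and \<nu>: "stable_law \<beta> \<tau> \<nu>" and b: "0 < b"
  shows "measure \<nu> {..<b} + measure \<nu> {b} / 2 = wright (- \<beta>) 1 (- \<tau> / b powr \<beta>)"
proof -
  interpret real_distribution \<nu> using \<nu> by (simp add: stable_law_def)
  define e :: "nat \<Rightarrow> real" where "e = (\<lambda>n. 1 / real (Suc n))"
  have e: "e \<longlonglongrightarrow> 0" "\<And>n. 0 < e n"
    unfolding e_def by real_asymp auto
  define w where "w = (\<lambda>n. Complex (- b) (e n))"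
  have w: "w n \<in> slit_plane" for n using e(2)[of n] by (auto simp: w_def complex_nonpos_Reals_iff)
  have cnt: "isCont (stable_log_series \<beta>) z" for z :: complex
    by (rule has_field_derivative_stable_log_series[OF \<beta>]) (rule DERIV_isCont)
  have "(\<lambda>n. log_stieltjes \<beta> \<tau> (w n)) \<longlonglongrightarrow> (Ln (of_real b) + \<i> * of_real pi) -
       stable_log_series \<beta> (- of_real \<tau> * exp (- of_real \<beta> * (Ln (of_real b) + \<i> * of_real pi)))"
    unfolding log_stieltjes_def frac_pow_arg_def w_def
    by (intro tendsto_intros tendsto_Ln_upper_side e b isCont_tendsto_compose[OF cnt])
  moreover have "Im (Ln (of_real b) + \<i> * of_real pi - S) = pi - Im S" for S
    using b by (simp add: Ln_of_real)
  ultimately have 1: "(\<lambda>n. Im (log_stieltjes \<beta> \<tau> (w n))) \<longlonglongrightarrow> pi * wright (- \<beta>) 1 (- \<tau> / b powr \<beta>)"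
    unfolding Im_log_stieltjes_limit[OF \<beta> b, symmetric] by (metis tendsto_Im)
  have 2: "(\<lambda>n. \<integral>s. Im (Ln (w n + of_real (max s 0))) \<partial>\<nu>) \<longlonglongrightarrow>
      (\<integral>s. pi * indicator {..<b} s + pi / 2 * indicator {b} s \<partial>\<nu>)"
  proof (rule integral_dominated_convergence[where w = "\<lambda>_. pi"])
    show "AE s in \<nu>. (\<lambda>n. Im (Ln (w n + of_real (max s 0)))) \<longlonglongrightarrow> pi * indicator {..<b} s + pi / 2 * indicator {b} s"
    proof (intro always_eventually allI)
      fix s
      have w_eq: "w n + of_real (max s 0) = Complex (- (b - max s 0)) (e n)" for n
        by (simp add: w_def complex_eq_iff)
      consider "s < b" | "s = b" | "s > b" by linarith
      thus "(\<lambda>n. Im (Ln (w n + of_real (max s 0)))) \<longlonglongrightarrow> pi * indicator {..<b} s + pi / 2 * indicator {b} s"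
      proof cases
        case 1
        have "(\<lambda>n. Im (Ln (w n + of_real (max s 0)))) \<longlonglongrightarrow> Im (Ln (of_real (b - max s 0)) + \<i> * of_real pi)"
          unfolding w_eq using 1 b by (intro tendsto_Im tendsto_Ln_upper_side e) auto
        also have "Im (Ln (of_real (b - max s 0)) + \<i> * of_real pi) = pi"
          using 1 b by (subst Ln_of_real) auto
        finally show ?thesis using 1 by simp
      next
        case 2
        have "Complex 0 (e n) = of_real (e n) * \<i>" for n by (simp add: complex_eq_iff)
        hence "Im (Ln (w n + of_real (max s 0))) = pi / 2" for n
          unfolding w_eq using 2 b e(2)[of n] by (simp add: Ln_times_of_real)
        hence "(\<lambda>n. Im (Ln (w n + of_real (max s 0)))) = (\<lambda>_. pi / 2)" by (intro ext)
        thus ?thesis using 2 by simp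
      next
        case 3
        have "(\<lambda>n. Im (Ln (of_real (s - b) + \<i> * of_real (e n)))) \<longlonglongrightarrow> Im (Ln (of_real (s - b) + \<i> * of_real 0))"
        proof (rule tendsto_Im, rule tendsto_Ln)
          show "(\<lambda>n. complex_of_real (s - b) + \<i> * of_real (e n)) \<longlonglongrightarrow> of_real (s - b) + \<i> * of_real 0"
            by (intro tendsto_intros e(1))
        qed (use 3 in \<open>simp add: complex_nonpos_Reals_iff\<close>)
        moreover have "w n + of_real (max s 0) = of_real (s - b) + \<i> * of_real (e n)" for n
          using 3 b by (simp add: w_def complex_eq_iff)
        moreover have "Im (Ln (of_real (s - b) + \<i> * of_real 0)) = 0"
          using 3 Ln_of_real[of "s - b"] by simp
        ultimately show ?thesis using 3 by simp
      qed
    qed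
    show "AE s in \<nu>. norm (Im (Ln (w n + of_real (max s 0)))) \<le> pi" for n
    proof (intro always_eventually allI)
      fix s
      have "w n + of_real (max s 0) \<noteq> 0" using slit_plane_add_nonneg[OF w[of n], of "max s 0"] by auto
      thus "norm (Im (Ln (w n + of_real (max s 0)))) \<le> pi"
        using mpi_less_Im_Ln[of "w n + of_real (max s 0)"] Im_Ln_le_pi[of "w n + of_real (max s 0)"] by simp
    qed
  qed auto
  have [simp]: "integrable \<nu> (indicator {..<b} :: real \<Rightarrow> real)" "integrable \<nu> (indicator {b} :: real \<Rightarrow> real)"
    by (auto intro!: integrable_real_indicator simp: emeasure_eq_measure)
  have "(\<integral>s. pi * indicator {..<b} s + pi / 2 * indicator {b} s \<partial>\<nu>) = pi * measure \<nu> {..<b} + pi / 2 * measure \<nu> {b}"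
    by (subst Bochner_Integration.integral_add) simp_all
  also have "\<dots> = pi * (measure \<nu> {..<b} + measure \<nu> {b} / 2)"
    by (simp add: ring_distribs)
  finally have "pi * wright (- \<beta>) 1 (- \<tau> / b powr \<beta>) = pi * (measure \<nu> {..<b} + measure \<nu> {b} / 2)"
    using LIMSEQ_unique[OF 1 2[unfolded expectation_Im_Ln[OF \<beta> \<nu> w]]] by (rule trans[rotated])
  hence "wright (- \<beta>) 1 (- \<tau> / b powr \<beta>) = measure \<nu> {..<b} + measure \<nu> {b} / 2"
    by (subst (asm) mult_cancel_left) (simp only: pi_neq_zero simp_thms)
  thus ?thesis by (rule sym)
qed

text \<open>The right-hand side is continuous in \<open>b\<close>, and an atom at \<open>b\<close> would make it jump.\<close>

lemma stable_law_lessThan: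
  assumes \<beta>: "0 < \<beta>" "\<beta> < 1" and \<nu>: "stable_law \<beta> \<tau> \<nu>" and b: "0 < b"
  shows "measure \<nu> {..<b} = wright (- \<beta>) 1 (- \<tau> / b powr \<beta>)" and "measure \<nu> {b} = 0"
proof -
  interpret real_distribution \<nu> using \<nu> by (simp add: stable_law_def)
  let ?F = "\<lambda>b. wright (- \<beta>) 1 (- \<tau> / b powr \<beta>)"
  note half = stable_law_lessThan_plus_half_atom[OF \<beta> \<nu>]
  have "continuous_on UNIV (wright (- \<beta>) 1 :: real \<Rightarrow> real)"
    using continuous_on_wright[OF \<beta>, of UNIV 0] by simp
  moreover have "continuous_on {0<..} (\<lambda>b. - \<tau> / b powr \<beta>)"
    by (intro continuous_intros) auto
  ultimately have "continuous_on {0<..} ?F"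
    by (rule continuous_on_compose2) auto
  hence "isCont ?F b" using b by (simp add: continuous_on_eq_continuous_at)
  moreover have "(\<lambda>n. b + 1 / real (Suc n)) \<longlonglongrightarrow> b" by real_asymp
  ultimately have "(\<lambda>n. ?F (b + 1 / real (Suc n))) \<longlonglongrightarrow> ?F b"
    by (rule isCont_tendsto_compose)
  moreover have "?F b + measure \<nu> {b} / 2 \<le> ?F (b + 1 / real (Suc n))" for n
  proof -
    let ?c = "b + 1 / real (Suc n)"
    have "?F b + measure \<nu> {b} / 2 = measure \<nu> {..<b} + measure \<nu> {b}"
      using half[OF b] by simp
    also have "\<dots> = measure \<nu> ({..<b} \<union> {b})"
      by (intro finite_measure_Union[symmetric]) auto
    also have "\<dots> \<le> measure \<nu> {..<?c}"
      by (intro finite_measure_mono) (auto intro: less_trans simp: add_strict_increasing)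
    also have "\<dots> \<le> ?F ?c"
    proof -
      have "0 < ?c" using b by (simp add: add_pos_pos)
      from half[OF this] show ?thesis using measure_nonneg[of \<nu> "{?c}"] by linarith
    qed
    finally show ?thesis .
  qed
  ultimately have "?F b + measure \<nu> {b} / 2 \<le> ?F b"
    by (intro LIMSEQ_le_const[of "\<lambda>n. ?F (b + 1 / real (Suc n))"]) auto
  thus *: "measure \<nu> {b} = 0" using measure_nonneg[of \<nu> "{b}"] by linarith
  show "measure \<nu> {..<b} = ?F b" using half[OF b] * by simp
qed

lemma stable_law_unique:
  assumes \<beta>: "0 < \<beta>" "\<beta> < 1" and \<mu>: "stable_law \<beta> \<tau> \<mu>" and \<nu>: "stable_law \<beta> \<tau> \<nu>"
  shows "\<mu> = \<nu>"
proof (rule cdf_unique)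
  show "real_distribution \<mu>" "real_distribution \<nu>" using \<mu> \<nu> by (auto simp: stable_law_def)
  have pos: "cdf \<kappa> b = wright (- \<beta>) 1 (- \<tau> / b powr \<beta>)" if \<kappa>: "stable_law \<beta> \<tau> \<kappa>" and b: "b > 0" for \<kappa> b
  proof -
    interpret real_distribution \<kappa> using \<kappa> by (simp add: stable_law_def)
    have "measure \<kappa> ({..<b} \<union> {b}) = measure \<kappa> {..<b} + measure \<kappa> {b}"
      by (intro finite_measure_Union) auto
    moreover have "{..<b} \<union> {b} = {..b}" by auto
    ultimately show ?thesis using stable_law_lessThan[OF \<beta> \<kappa> b] by (simp add: cdf_def)
  qed
  have neg: "cdf \<kappa> b = 0" if \<kappa>: "stable_law \<beta> \<tau> \<kappa>" and b: "b < 0" for \<kappa> b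
  proof -
    interpret real_distribution \<kappa> using \<kappa> by (simp add: stable_law_def)
    have "AE s in \<kappa>. 0 \<le> s" using \<kappa> by (simp add: stable_law_def)
    hence "AE s in \<kappa>. s \<notin> {..b}" by (rule eventually_mono) (use b in auto)
    thus ?thesis by (simp add: cdf_def prob_eq_0)
  qed
  show "cdf \<mu> = cdf \<nu>"
  proof
    fix b :: real
    consider "b < 0" | "b = 0" | "b > 0" by linarith
    thus "cdf \<mu> b = cdf \<nu> b"
    proof cases
      case 2
      have right: "(\<lambda>n. cdf \<kappa> (1 / real (Suc n))) \<longlonglongrightarrow> cdf \<kappa> 0" if "stable_law \<beta> \<tau> \<kappa>" for \<kappa>
      proof -
        interpret real_distribution \<kappa> using that by (simp add: stable_law_def)
        have "filterlim (\<lambda>n. 1 / real (Suc n)) (at_right 0) sequentially" by real_asymp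
        from filterlim_compose[OF cdf_is_right_cont[of 0, unfolded continuous_within] this] show ?thesis .
      qed
      have "cdf \<mu> (1 / real (Suc n)) = cdf \<nu> (1 / real (Suc n))" for n
        using pos[OF \<mu>] pos[OF \<nu>] by simp
      with LIMSEQ_unique[OF right[OF \<mu>]] right[OF \<nu>] 2 show ?thesis by simp
    qed (use pos[OF \<mu>] pos[OF \<nu>] neg[OF \<mu>] neg[OF \<nu>] in auto)
  qed
qed

section \<open>The law of the weighted sum of stable subordinators\<close>

text \<open>At \<open>\<tau> = 0\<close> the law is degenerate, because the nonnegative variable \<open>1 - exp (- s)\<close> has mean zero.\<close>

lemma stable_law_0:
  assumes "stable_law \<beta> 0 \<nu>"
  shows "\<nu> = return borel 0"
proof -
  interpret real_distribution \<nu> using assms by (simp add: stable_law_def)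
  have ge: "AE s in \<nu>. 0 \<le> s" using assms by (simp add: stable_law_def)
  have int: "integrable \<nu> (\<lambda>s. exp (- s))"
    using ge by (intro integrable_const_bound[of _ 1]) (auto elim!: eventually_mono)
  have "(\<integral>s. exp (- 1 * s) \<partial>\<nu>) = exp (- 0 * 1 powr \<beta>)"
    using assms unfolding stable_law_def by (metis zero_le_one)
  hence "(\<integral>s. 1 - exp (- s) \<partial>\<nu>) = 0"
    using int prob_space by simp
  hence "AE s in \<nu>. 1 - exp (- s) = 0"
    using int ge by (subst (asm) integral_nonneg_eq_0_iff_AE) (auto elim!: eventually_mono)
  hence eq: "AE s in \<nu>. s = 0" by (rule eventually_mono) auto
  have "\<nu> = distr \<nu> borel (\<lambda>s. s)" by (rule distr_id2[symmetric]) simp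
  also have "\<dots> = distr \<nu> borel (\<lambda>_. 0)"
    using eq by (intro distr_cong_AE) auto
  also have "\<dots> = return borel 0" by (rule distr_const) auto
  finally show ?thesis .
qed

lemma stable_lawI:
  assumes "prob_space M" and T [measurable]: "T \<in> borel_measurable M" and "AE \<omega> in M. 0 \<le> T \<omega>"
    and "\<And>\<xi>. 0 \<le> \<xi> \<Longrightarrow> (\<integral>\<omega>. exp (- \<xi> * T \<omega>) \<partial>M) = exp (- \<tau> * \<xi> powr \<beta>)"
  shows "stable_law \<beta> \<tau> (distr M borel T)"
proof -
  interpret prob_space M by fact
  show ?thesis
    unfolding stable_law_def using assms by (auto simp: AE_distr_iff integral_distr)
qed

lemma stable_subordinator_nonneg:
  assumes "stable_subordinator \<beta> M H" "0 \<le> t"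
  shows "AE \<omega> in M. 0 \<le> H t \<omega>"
proof -
  have "AE \<omega> in M. H 0 \<omega> = 0" "AE \<omega> in M. mono_on {0..} (\<lambda>t. H t \<omega>)"
    using assms unfolding stable_subordinator_def subordinator_def by (auto elim!: eventually_mono)
  thus ?thesis
  proof eventually_elim
    case (elim \<omega>)
    have "H 0 \<omega> \<le> H t \<omega>" using elim(2) assms(2) by (auto intro: mono_onD)
    with elim(1) show ?case by simp
  qed
qed

lemma stable_subordinator_law:
  assumes "stable_subordinator \<beta> M H" "0 \<le> t"
  shows "stable_law \<beta> t (distr M borel (H t))"
  using assms stable_subordinator_nonneg[OF assms]
  by (intro stable_lawI) (auto simp: stable_subordinator_def subordinator_def)

lemma borel_measurable_stable_sum:
  assumes "\<And>j. stable_subordinator \<beta> M (H j)" "x \<in> nonneg_orthant"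
  shows "stable_sum \<beta> a H x \<in> borel_measurable M"
proof -
  have "H j (x $ j) \<in> borel_measurable M" for j
    using assms by (auto simp: stable_subordinator_def subordinator_def nonneg_orthant_def)
  thus ?thesis unfolding stable_sum_def[abs_def] by measurable
qed

text \<open>The scaling \<open>(a $ j) powr (1 / \<beta>)\<close> becomes a factor \<open>a $ j\<close> in front of \<open>\<xi> powr \<beta>\<close>, and by independence
  the exponents add up to \<open>a \<bullet> x\<close>.\<close>

lemma stable_sum_law:
  fixes a x :: "real ^ 'n"
  assumes \<beta>: "0 < \<beta>" and a: "\<And>j. 0 \<le> a $ j" and H: "\<And>j. stable_subordinator \<beta> M (H j)"
    and indep: "independent_processes M H" and x: "x \<in> nonneg_orthant"
  shows "stable_law \<beta> (a \<bullet> x) (distr M borel (stable_sum \<beta> a H x))"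
proof -
  interpret prob_space M using H by (auto simp: stable_subordinator_def subordinator_def)
  have x0: "0 \<le> x $ j" for j using x by (auto simp: nonneg_orthant_def)
  have Hm [measurable]: "H j (x $ j) \<in> borel_measurable M" for j
    using H x0 by (auto simp: stable_subordinator_def subordinator_def)
  have nonneg: "AE \<omega> in M. \<forall>j\<in>UNIV. 0 \<le> H j (x $ j) \<omega>"
    using stable_subordinator_nonneg[OF H x0] by (intro AE_finite_allI) auto
  have "indep_vars (\<lambda>_. borel) (\<lambda>j \<omega>. (\<lambda>t\<in>{0..}. H j t \<omega>) (x $ j)) UNIV"
    using indep unfolding independent_processes_def
    by (rule indep_vars_compose2) (use x0 in \<open>auto intro: measurable_component_singleton\<close>)
  hence iH: "indep_vars (\<lambda>_. borel) (\<lambda>j. H j (x $ j)) UNIV" using x0 by simp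
  show ?thesis
  proof (rule stable_lawI)
    show "stable_sum \<beta> a H x \<in> borel_measurable M"
      by (rule borel_measurable_stable_sum[OF H x])
    show "AE \<omega> in M. 0 \<le> stable_sum \<beta> a H x \<omega>"
      using nonneg by eventually_elim (auto simp: stable_sum_def intro!: sum_nonneg)
    fix \<xi> :: real assume \<xi>: "0 \<le> \<xi>"
    let ?E = "\<lambda>j y. exp (- (\<xi> * a $ j powr (1 / \<beta>)) * y)"
    have "(\<integral>\<omega>. exp (- \<xi> * stable_sum \<beta> a H x \<omega>) \<partial>M) = (\<integral>\<omega>. (\<Prod>j\<in>UNIV. ?E j (H j (x $ j) \<omega>)) \<partial>M)"
      by (intro Bochner_Integration.integral_cong refl)
         (simp add: stable_sum_def sum_distrib_left mult_ac flip: exp_sum sum_negf)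
    also have "\<dots> = (\<Prod>j\<in>UNIV. \<integral>\<omega>. ?E j (H j (x $ j) \<omega>) \<partial>M)"
    proof (rule indep_vars_lebesgue_integral)
      show "indep_vars (\<lambda>_. borel) (\<lambda>j \<omega>. ?E j (H j (x $ j) \<omega>)) UNIV"
        by (rule indep_vars_compose2[OF iH]) auto
      show "integrable M (\<lambda>\<omega>. ?E j (H j (x $ j) \<omega>))" for j
      proof (rule integrable_const_bound)
        show "AE \<omega> in M. norm (?E j (H j (x $ j) \<omega>)) \<le> 1"
          using nonneg by eventually_elim (use \<xi> in auto)
      qed measurable
    qed auto
    also have "\<dots> = (\<Prod>j\<in>UNIV. exp (- (a $ j * x $ j) * \<xi> powr \<beta>))"
    proof (intro prod.cong refl)
      fix j
      have "(\<integral>\<omega>. ?E j (H j (x $ j) \<omega>) \<partial>M) = exp (- x $ j * (\<xi> * a $ j powr (1 / \<beta>)) powr \<beta>)"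
        using H[of j] x0[of j] \<xi> unfolding stable_subordinator_def by simp
      also have "(\<xi> * a $ j powr (1 / \<beta>)) powr \<beta> = \<xi> powr \<beta> * a $ j"
        using \<beta> \<xi> a[of j] by (simp add: powr_mult powr_powr)
      finally show "(\<integral>\<omega>. ?E j (H j (x $ j) \<omega>) \<partial>M) = exp (- (a $ j * x $ j) * \<xi> powr \<beta>)"
        by (simp add: mult_ac)
    qed
    also have "\<dots> = exp (- (a \<bullet> x) * \<xi> powr \<beta>)"
      by (simp add: inner_vec_def sum_distrib_right flip: exp_sum sum_negf)
    finally show "(\<integral>\<omega>. exp (- \<xi> * stable_sum \<beta> a H x \<omega>) \<partial>M) = exp (- (a \<bullet> x) * \<xi> powr \<beta>)" .
  qed (rule prob_space_axioms)
qed

lemma stable_sum_density: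
  fixes a x :: "real ^ 'n"
  assumes \<beta>: "0 < \<beta>" "\<beta> < 1" and a: "\<And>j. 0 \<le> a $ j" and H: "\<And>j. stable_subordinator \<beta> M (H j)"
    and indep: "independent_processes M H" and x: "x \<in> nonneg_orthant"
    and G: "stable_subordinator \<beta> M\<^sub>0 G" and h: "distributed M\<^sub>0 lborel (G (a \<bullet> x)) f"
  shows "distributed M lborel (stable_sum \<beta> a H x) f"
proof -
  have "0 \<le> a \<bullet> x"
    using a x by (auto simp: inner_vec_def nonneg_orthant_def intro!: sum_nonneg)
  have "distr M lborel (stable_sum \<beta> a H x) = distr M borel (stable_sum \<beta> a H x)"
    by (rule distr_cong) auto
  also have "\<dots> = distr M\<^sub>0 borel (G (a \<bullet> x))"
    using stable_law_unique[OF \<beta> stable_sum_law[OF \<beta>(1) a H indep x] stable_subordinator_law[OF G \<open>0 \<le> a \<bullet> x\<close>]] .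
  also have "\<dots> = distr M\<^sub>0 lborel (G (a \<bullet> x))"
    by (rule distr_cong) auto
  finally show ?thesis
    using h borel_measurable_stable_sum[OF H x, of a] by (simp add: distributed_def)
qed

lemma prob_stable_sum_less:
  fixes a x :: "real ^ 'n"
  assumes \<beta>: "0 < \<beta>" "\<beta> < 1" and a: "\<And>j. 0 \<le> a $ j" and H: "\<And>j. stable_subordinator \<beta> M (H j)"
    and indep: "independent_processes M H" and x: "x \<in> nonneg_orthant" and t: "0 < t"
  shows "measure M {\<omega> \<in> space M. stable_sum \<beta> a H x \<omega> < t} = wright (- \<beta>) 1 (- (a \<bullet> x) / t powr \<beta>)"
proof -
  have "measure M {\<omega> \<in> space M. stable_sum \<beta> a H x \<omega> < t} = measure (distr M borel (stable_sum \<beta> a H x)) {..<t}"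
    using borel_measurable_stable_sum[OF H x, of a] by (subst measure_distr) (auto intro!: arg_cong[where f = "measure M"])
  also have "\<dots> = wright (- \<beta>) 1 (- (a \<bullet> x) / t powr \<beta>)"
    by (rule stable_law_lessThan(1)[OF \<beta> stable_sum_law[OF \<beta>(1) a H indep x] t])
  finally show ?thesis .
qed

section \<open>Box probabilities from survival functions\<close>

text \<open>The coordinates in \<open>J\<close> run through the box, the others stay at the corner \<open>x\<close>. Every coordinate in
  \<open>J\<close> accounts for one derivative in the chain \<open>V 0, V 1, \<dots>\<close> and one chain-rule factor \<open>c j\<close>.\<close>

definition box_density :: "(nat \<Rightarrow> real \<Rightarrow> real) \<Rightarrow> ('n::finite \<Rightarrow> real) \<Rightarrow> ('n \<Rightarrow> real) \<Rightarrow> ('n \<Rightarrow> real) \<Rightarrow> 'n set \<Rightarrow> ('n \<Rightarrow> real) \<Rightarrow> real" where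
  "box_density V c x y J z = (\<Prod>j\<in>J. c j * indicator {x j<..y j} (z j)) *
     V (card J) (- ((\<Sum>j\<in>J. c j * z j) + (\<Sum>j\<in>-J. c j * x j)))"

lemma integrable_box_density:
  fixes c x y :: "'n::finite \<Rightarrow> real"
  assumes V: "\<And>m. continuous_on UNIV (V m)" and c: "\<And>j. 0 \<le> c j" and x: "\<And>j. 0 \<le> x j"
  shows "integrable (Pi\<^sub>M J (\<lambda>_. lborel)) (box_density V c x y J)"
proof -
  interpret product_sigma_finite "\<lambda>_::'n. lborel :: real measure" ..
  let ?P = "\<lambda>z. \<Prod>j\<in>J. c j * indicator {x j<..y j} (z j)"
  let ?B = "(\<Sum>j\<in>J. c j * y j) + (\<Sum>j\<in>-J. c j * x j)"
  have [measurable]: "V m \<in> borel_measurable borel" for m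
    by (rule borel_measurable_continuous_onI[OF V])
  have "compact (V (card J) ` {- ?B..0})"
    by (intro compact_continuous_image continuous_on_subset[OF V]) auto
  hence "bounded (V (card J) ` {- ?B..0})" by (rule compact_imp_bounded)
  then obtain K where K: "\<And>u. u \<in> {- ?B..0} \<Longrightarrow> \<bar>V (card J) u\<bar> \<le> K"
    unfolding bounded_iff real_norm_def by blast
  show ?thesis
  proof (rule Bochner_Integration.integrable_bound)
    have "integrable lborel (indicator {a<..b} :: real \<Rightarrow> real)" for a b
      by (cases "a \<le> b") (auto intro!: integrable_real_indicator)
    hence "integrable (Pi\<^sub>M J (\<lambda>_. lborel)) ?P"
      by (intro product_integrable_prod) auto
    thus "integrable (Pi\<^sub>M J (\<lambda>_. lborel)) (\<lambda>z. ?P z * K)" by (rule integrable_mult_left)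
    show "box_density V c x y J \<in> borel_measurable (Pi\<^sub>M J (\<lambda>_. lborel))"
      unfolding box_density_def by measurable
    show "AE z in Pi\<^sub>M J (\<lambda>_. lborel). norm (box_density V c x y J z) \<le> norm (?P z * K)"
    proof (intro always_eventually allI)
      fix z :: "'n \<Rightarrow> real"
      show "norm (box_density V c x y J z) \<le> norm (?P z * K)"
      proof (cases "\<forall>j\<in>J. z j \<in> {x j<..y j}")
        case True
        let ?s = "(\<Sum>j\<in>J. c j * z j) + (\<Sum>j\<in>-J. c j * x j)"
        have "0 \<le> z j" if "j \<in> J" for j using True that x[of j] by force
        hence "0 \<le> ?s" using c x by (intro add_nonneg_nonneg sum_nonneg mult_nonneg_nonneg) auto
        moreover have "?s \<le> ?B" using True c by (intro add_mono sum_mono mult_left_mono) auto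
        ultimately have "\<bar>V (card J) (- ?s)\<bar> \<le> \<bar>K\<bar>" using K[of "- ?s"] by auto
        thus ?thesis unfolding box_density_def by (simp add: abs_mult mult_left_mono)
      next
        case False
        hence P0: "?P z = 0" by (intro prod_zero) (auto simp: indicator_def)
        show ?thesis unfolding box_density_def P0 by simp
      qed
    qed
  qed
qed

text \<open>Induction on the set of bounded coordinates. Bounding one more coordinate \<open>i\<close> subtracts the
  probability with corner \<open>x\<close> replaced by \<open>x(i := y i)\<close>, and by the fundamental theorem of calculus this
  difference is an integral of the next derivative over \<open>{x i<..y i}\<close>. Hence \<open>x\<close> has to be arbitrary in the
  induction.\<close>

lemma measure_box_eq_integral:
  fixes X :: "'n::finite \<Rightarrow> 'b \<Rightarrow> ereal" and c x y :: "'n \<Rightarrow> real"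
  assumes N: "prob_space N" and X [measurable]: "\<And>j. X j \<in> borel_measurable N"
    and V: "\<And>m u. (V m has_real_derivative V (Suc m) u) (at u)"
    and c: "\<And>j. 0 \<le> c j" 
    and surv: "\<And>x. (\<And>j. 0 \<le> x j) \<Longrightarrow> measure N {\<omega> \<in> space N. \<forall>j. ereal (x j) < X j \<omega>} = V 0 (- (\<Sum>j\<in>UNIV. c j * x j))"
    and x: "\<And>j. 0 \<le> x j" and xy: "\<And>j. x j \<le> y j"
  shows "measure N {\<omega> \<in> space N. (\<forall>j. ereal (x j) < X j \<omega>) \<and> (\<forall>j\<in>J. X j \<omega> \<le> ereal (y j))} =
           (\<integral>z. box_density V c x y J z \<partial>Pi\<^sub>M J (\<lambda>_. lborel))"
proof -
  interpret prob_space N by fact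
  interpret product_sigma_finite "\<lambda>_::'n. lborel :: real measure" ..
  have Vc: "continuous_on UNIV (V m)" for m
    using V by (intro continuous_at_imp_continuous_on) (auto intro: DERIV_isCont)
  let ?E = "\<lambda>J x. {\<omega> \<in> space N. (\<forall>j. ereal (x j) < X j \<omega>) \<and> (\<forall>j\<in>J. X j \<omega> \<le> ereal (y j))}"
  have [measurable]: "?E J x \<in> sets N" for J x by measurable
  have "finite J" by simp
  thus ?thesis using x xy
  proof (induction J arbitrary: x rule: finite_induct)
    case empty
    thus ?case
      by (simp add: surv PiM_empty lebesgue_integral_count_space_finite box_density_def)
  next
    case (insert i J x)
    let ?x' = "x(i := y i)"
    have x': "\<And>j. 0 \<le> ?x' j" "\<And>j. ?x' j \<le> y j"
      using insert.prems by (auto intro: order_trans)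
    have split: "?E (insert i J) x = ?E J x - ?E J ?x'"
      using insert.prems(2) insert.hyps(2) by (auto simp: not_less fun_upd_def split: if_splits)
    have sub: "?E J ?x' \<subseteq> ?E J x"
    proof (intro Collect_mono impI conjI allI; elim conjE)
      fix \<omega> j assume *: "\<forall>j. ereal (?x' j) < X j \<omega>"
      have "ereal (x j) \<le> ereal (?x' j)" using insert.prems(2) by auto
      also have "\<dots> < X j \<omega>" using * by blast
      finally show "ereal (x j) < X j \<omega>" .
    qed
    define A where "A = (\<lambda>z. (\<Sum>j\<in>J. c j * z j) + (\<Sum>j\<in>- insert i J. c j * x j))"
    let ?P = "\<lambda>z. \<Prod>j\<in>J. c j * indicator {x j<..y j} (z j)"
    have comp: "- J = insert i (- insert i J)" using insert.hyps by auto
    have dens: "box_density V c x y J z = ?P z * V (card J) (- (A z + c i * x i))" for z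
      unfolding box_density_def A_def comp by (subst sum.insert) (auto simp: algebra_simps)
    have dens': "box_density V c ?x' y J z = ?P z * V (card J) (- (A z + c i * y i))" for z
    proof -
      have "(\<Sum>j\<in>- insert i J. c j * ?x' j) = (\<Sum>j\<in>- insert i J. c j * x j)" by (intro sum.cong) auto
      moreover have "(\<Prod>j\<in>J. c j * indicator {?x' j<..y j} (z j)) = ?P z"
        using insert.hyps by (intro prod.cong) auto
      ultimately show ?thesis
        unfolding box_density_def A_def comp by (subst sum.insert) (auto simp: algebra_simps)
    qed
    have "measure N (?E (insert i J) x) = measure N (?E J x) - measure N (?E J ?x')"
      unfolding split using sub by (intro finite_measure_Diff) auto
    also have "\<dots> = (\<integral>z. box_density V c x y J z \<partial>Pi\<^sub>M J (\<lambda>_. lborel)) - (\<integral>z. box_density V c ?x' y J z \<partial>Pi\<^sub>M J (\<lambda>_. lborel))"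
      by (simp only: insert.IH[OF insert.prems] insert.IH[OF x'])
    also have "\<dots> = (\<integral>z. box_density V c x y J z - box_density V c ?x' y J z \<partial>Pi\<^sub>M J (\<lambda>_. lborel))"
      by (intro Bochner_Integration.integral_diff[symmetric] integrable_box_density Vc c insert.prems(1) x'(1))
    also have "\<dots> = (\<integral>z. (\<integral>u. box_density V c x y (insert i J) (z(i := u)) \<partial>lborel) \<partial>Pi\<^sub>M J (\<lambda>_. lborel))"
    proof (intro Bochner_Integration.integral_cong refl)
      fix z :: "'n \<Rightarrow> real"
      let ?f = "\<lambda>u. c i * V (Suc (card J)) (- (A z + c i * u))"
      have "(\<integral>u. ?f u * indicator {x i<..y i} u \<partial>lborel) = (\<integral>u. ?f u * indicator {x i..y i} u \<partial>lborel)"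
      proof (rule integral_cong_AE)
        have "AE u in lborel. u \<noteq> x i" by (rule AE_lborel_singleton)
        thus "AE u in lborel. ?f u * indicator {x i<..y i} u = ?f u * indicator {x i..y i} u"
          by eventually_elim (auto simp: indicator_def)
        have [measurable]: "V m \<in> borel_measurable borel" for m
          by (rule borel_measurable_continuous_onI[OF Vc])
        show "(\<lambda>u. ?f u * indicator {x i<..y i} u) \<in> borel_measurable lborel"
          "(\<lambda>u. ?f u * indicator {x i..y i} u) \<in> borel_measurable lborel" by measurable
      qed
      also have "\<dots> = - V (card J) (- (A z + c i * y i)) - (- V (card J) (- (A z + c i * x i)))"
      proof (rule integral_FTC_Icc_real)
        show "x i \<le> y i" by (rule insert.prems)
        fix u
        show "((\<lambda>u. - V (card J) (- (A z + c i * u))) has_real_derivative ?f u) (at u)"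
          by (auto intro!: derivative_eq_intros DERIV_chain2[OF V])
        have "continuous_on UNIV ?f"
          by (intro continuous_intros continuous_on_compose2[OF Vc]) auto
        thus "isCont ?f u" by (simp add: continuous_on_eq_continuous_at)
      qed
      finally have FTC: "(\<integral>u. ?f u * indicator {x i<..y i} u \<partial>lborel) = - V (card J) (- (A z + c i * y i)) - (- V (card J) (- (A z + c i * x i)))" .
      have "box_density V c x y J z - box_density V c ?x' y J z = ?P z * (\<integral>u. ?f u * indicator {x i<..y i} u \<partial>lborel)"
        unfolding dens dens' FTC by (simp add: algebra_simps)
      also have "\<dots> = (\<integral>u. ?P z * (?f u * indicator {x i<..y i} u) \<partial>lborel)" by simp
      also have "\<dots> = (\<integral>u. box_density V c x y (insert i J) (z(i := u)) \<partial>lborel)"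
      proof (intro Bochner_Integration.integral_cong refl)
        fix u :: real
        have 1: "(\<Prod>j\<in>J. c j * indicator {x j<..y j} ((z(i := u)) j)) = ?P z"
          using insert.hyps by (intro prod.cong) auto
        have 2: "(\<Sum>j\<in>J. c j * (z(i := u)) j) = (\<Sum>j\<in>J. c j * z j)"
          using insert.hyps by (intro sum.cong) auto
        show "?P z * (?f u * indicator {x i<..y i} u) = box_density V c x y (insert i J) (z(i := u))"
          unfolding box_density_def prod.insert[OF insert.hyps] sum.insert[OF insert.hyps] 1 2 card_insert_disjoint[OF insert.hyps]
          by (simp add: A_def algebra_simps)
      qed
      finally show "box_density V c x y J z - box_density V c ?x' y J z = (\<integral>u. box_density V c x y (insert i J) (z(i := u)) \<partial>lborel)" .
    qed
    also have "\<dots> = (\<integral>z. box_density V c x y (insert i J) z \<partial>Pi\<^sub>M (insert i J) (\<lambda>_. lborel))"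
      by (intro product_integral_insert[symmetric] insert.hyps integrable_box_density Vc c insert.prems(1))
    finally show ?case .
  qed
qed

lemma lborel_eq_distr_PiM:
  "(lborel :: (real ^ 'n) measure) = distr (Pi\<^sub>M UNIV (\<lambda>_. lborel)) borel (\<lambda>f. \<chi> j. f j)"
proof (rule lborel_eqI)
  interpret product_sigma_finite "\<lambda>_::'n. lborel :: real measure" ..
  have [measurable]: "(\<lambda>f. \<chi> j. f j) \<in> borel_measurable (Pi\<^sub>M (UNIV :: 'n set) (\<lambda>_. lborel :: real measure))"
    by (subst borel_measurable_euclidean_space) (auto simp: Basis_vec_def inner_axis)
  fix l u :: "real ^ 'n" assume lu: "\<And>b. b \<in> Basis \<Longrightarrow> l \<bullet> b \<le> u \<bullet> b"
  have le: "l $ j \<le> u $ j" for j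
    using lu[of "axis j 1"] by (auto simp: Basis_vec_def inner_axis)
  have "(\<lambda>f. \<chi> j. f j) -` box l u \<inter> space (Pi\<^sub>M UNIV (\<lambda>_. lborel)) = Pi\<^sub>E UNIV (\<lambda>j. {l $ j<..<u $ j})"
    by (auto simp: mem_box_cart space_PiM PiE_iff)
  hence "emeasure (distr (Pi\<^sub>M UNIV (\<lambda>_. lborel)) borel (\<lambda>f. \<chi> j. f j)) (box l u) = 
      emeasure (Pi\<^sub>M UNIV (\<lambda>_. lborel)) (Pi\<^sub>E UNIV (\<lambda>j. {l $ j<..<u $ j}))"
    by (subst emeasure_distr) auto
  also have "\<dots> = (\<Prod>j\<in>UNIV. ennreal (u $ j - l $ j))"
    using le by (subst emeasure_PiM) auto
  also have "\<dots> = ennreal (\<Prod>j\<in>UNIV. u $ j - l $ j)"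
    using le by (subst prod_ennreal) auto
  also have "(\<Prod>j\<in>UNIV. u $ j - l $ j) = (\<Prod>b\<in>(\<lambda>j. axis j 1) ` UNIV. (u - l) \<bullet> b)"
    by (subst prod.reindex) (auto simp: inj_on_def axis_eq_axis inner_axis)
  also have "(\<lambda>j. axis j 1) ` UNIV = (Basis :: (real ^ 'n) set)"
    by (auto simp: Basis_vec_def)
  finally show "emeasure (distr (Pi\<^sub>M UNIV (\<lambda>_. lborel)) borel (\<lambda>f. \<chi> j. f j)) (box l u) = ennreal (\<Prod>b\<in>Basis. (u - l) \<bullet> b)" .
qed auto

text \<open>Half-open boxes, because survival functions give the probabilities of such boxes without any
  information on atoms.\<close>

definition hbox :: "real ^ 'n \<Rightarrow> real ^ 'n \<Rightarrow> (real ^ 'n) set" where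
  "hbox x y = {z. \<forall>j. x $ j < z $ j \<and> z $ j \<le> y $ j}"

lemma measure_hbox_eq_integral:
  fixes X :: "'n::finite \<Rightarrow> 'b \<Rightarrow> ereal" and c x y :: "real ^ 'n"
  assumes N: "prob_space N" and X: "\<And>j. X j \<in> borel_measurable N"
    and V: "\<And>m u. (V m has_real_derivative V (Suc m) u) (at u)"
    and c: "\<And>j. 0 \<le> c $ j" 
    and surv: "\<And>x. x \<in> nonneg_orthant \<Longrightarrow> measure N {\<omega> \<in> space N. \<forall>j. ereal (x $ j) < X j \<omega>} = V 0 (- (c \<bullet> x))"
    and x: "x \<in> nonneg_orthant" and xy: "\<And>j. x $ j \<le> y $ j"
  shows "measure N {\<omega> \<in> space N. \<forall>j. ereal (x $ j) < X j \<omega> \<and> X j \<omega> \<le> ereal (y $ j)} =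
           (\<integral>z. indicator (hbox x y) z * ((\<Prod>j\<in>UNIV. c $ j) * V CARD('n) (- (c \<bullet> z))) \<partial>lborel)"
proof -
  have Vc: "continuous_on UNIV (V m)" for m
    using V by (intro continuous_at_imp_continuous_on) (auto intro: DERIV_isCont)
  have [measurable]: "V m \<in> borel_measurable borel" for m
    by (rule borel_measurable_continuous_onI[OF Vc])
  have [measurable]: "(\<lambda>f. \<chi> j. f j) \<in> borel_measurable (Pi\<^sub>M (UNIV :: 'n set) (\<lambda>_. lborel :: real measure))"
    by (subst borel_measurable_euclidean_space) (auto simp: Basis_vec_def inner_axis)
  have surv': "measure N {\<omega> \<in> space N. \<forall>j. ereal (x j) < X j \<omega>} = V 0 (- (\<Sum>j\<in>UNIV. c $ j * x j))" 
    if "\<And>j. 0 \<le> x j" for x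
    using surv[of "\<chi> j. x j"] that by (simp add: nonneg_orthant_def inner_vec_def)
  have [measurable]: "hbox x y \<in> sets borel"
    unfolding hbox_def by measurable
  have "measure N {\<omega> \<in> space N. \<forall>j. ereal (x $ j) < X j \<omega> \<and> X j \<omega> \<le> ereal (y $ j)} =
      measure N {\<omega> \<in> space N. (\<forall>j. ereal (x $ j) < X j \<omega>) \<and> (\<forall>j\<in>UNIV. X j \<omega> \<le> ereal (y $ j))}"
    by (intro arg_cong[where f = "measure N"]) auto
  also have "\<dots> = (\<integral>z. box_density V (\<lambda>j. c $ j) (\<lambda>j. x $ j) (\<lambda>j. y $ j) UNIV z \<partial>Pi\<^sub>M UNIV (\<lambda>_. lborel))"
    using x by (intro measure_box_eq_integral N X V c surv' xy) (auto simp: nonneg_orthant_def)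
  also have "\<dots> = (\<integral>f. indicator (hbox x y) (\<chi> j. f j) * ((\<Prod>j\<in>UNIV. c $ j) * V CARD('n) (- (c \<bullet> (\<chi> j. f j)))) \<partial>Pi\<^sub>M UNIV (\<lambda>_. lborel))"
  proof (intro Bochner_Integration.integral_cong refl)
    fix f :: "'n \<Rightarrow> real"
    have "(\<Prod>j\<in>UNIV. indicator {x $ j<..y $ j} (f j)) = (indicator (hbox x y) (\<chi> j. f j) :: real)"
      by (auto simp: hbox_def indicator_def)
    thus "box_density V (\<lambda>j. c $ j) (\<lambda>j. x $ j) (\<lambda>j. y $ j) UNIV f = 
        indicator (hbox x y) (\<chi> j. f j) * ((\<Prod>j\<in>UNIV. c $ j) * V CARD('n) (- (c \<bullet> (\<chi> j. f j))))"
      by (simp add: box_density_def prod.distrib inner_vec_def)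
  qed
  also have "\<dots> = (\<integral>z. indicator (hbox x y) z * ((\<Prod>j\<in>UNIV. c $ j) * V CARD('n) (- (c \<bullet> z))) \<partial>lborel)"
    unfolding lborel_eq_distr_PiM by (subst integral_distr) auto
  finally show ?thesis .
qed

section \<open>Densities on the orthant\<close>

text \<open>Markov's inequality for \<open>exp (- s)\<close>.\<close>

lemma stable_law_lessThan_le:
  assumes "stable_law \<beta> \<tau> \<nu>"
  shows "measure \<nu> {..<t} \<le> exp (t - \<tau>)"
proof -
  interpret real_distribution \<nu> using assms by (simp add: stable_law_def)
  have ge: "AE s in \<nu>. 0 \<le> s" using assms by (simp add: stable_law_def)
  have int: "integrable \<nu> (\<lambda>s. exp (- s))"
    using ge by (intro integrable_const_bound[of _ 1]) (auto elim!: eventually_mono)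
  have E: "(\<integral>s. exp (- s) \<partial>\<nu>) = exp (- \<tau>)"
    using assms by (auto simp: stable_law_def dest!: spec[of _ 1])
  have "measure \<nu> {..<t} = (\<integral>s. indicator {..<t} s \<partial>\<nu>)" by simp
  also have "\<dots> \<le> (\<integral>s. exp t * exp (- s) \<partial>\<nu>)"
  proof (rule integral_mono)
    show "integrable \<nu> (indicator {..<t} :: real \<Rightarrow> real)"
      by (auto intro!: integrable_real_indicator simp: emeasure_eq_measure)
    show "integrable \<nu> (\<lambda>s. exp t * exp (- s))" using int by simp
    show "indicator {..<t} s \<le> exp t * exp (- s)" for s
      by (simp add: indicator_def flip: exp_add)
  qed
  also have "\<dots> = exp (t - \<tau>)" unfolding integral_mult_right_zero E by (simp flip: exp_add)
  finally show ?thesis .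
qed

lemma hbox_borel [measurable]: "hbox x y \<in> sets borel"
  unfolding hbox_def by measurable

lemma integrable_hbox:
  fixes p :: "real ^ 'n \<Rightarrow> real"
  assumes "continuous_on UNIV p"
  shows "integrable lborel (\<lambda>z. indicator (hbox x y) z * p z)"
proof -
  have [measurable]: "p \<in> borel_measurable borel" by (rule borel_measurable_continuous_onI[OF assms])
  have "integrable lborel (\<lambda>z. indicator (cbox x y) z *\<^sub>R p z)"
    by (rule borel_integrable_compact) (auto intro: continuous_on_subset[OF assms])
  moreover have "hbox x y \<subseteq> cbox x y" by (auto simp: hbox_def mem_box_cart less_imp_le)
  hence "norm (indicator (hbox x y) z * p z) \<le> norm (indicator (cbox x y) z *\<^sub>R p z)" for z
    by (auto simp: indicator_def)
  ultimately show ?thesis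
    by (rule_tac Bochner_Integration.integrable_bound) auto
qed

text \<open>At a point of negativity, a small box with lower corner \<open>x\<close> would have a negative integral. Boxes with
  lower corner \<open>x\<close> suffice, which matters on the boundary of the orthant.\<close>

lemma nonneg_if_hbox_integrals_nonneg:
  fixes p :: "real ^ 'n \<Rightarrow> real"
  assumes p: "continuous_on UNIV p"
    and nn: "\<And>y. (\<And>j. x $ j \<le> y $ j) \<Longrightarrow> 0 \<le> (\<integral>z. indicator (hbox x y) z * p z \<partial>lborel)"
  shows "0 \<le> p x"
proof (rule ccontr)
  assume "\<not> 0 \<le> p x"
  hence neg: "p x < 0" by simp
  have "isCont p x" using p by (simp add: continuous_on_eq_continuous_at)
  then obtain d where d: "d > 0" "\<And>z. dist z x < d \<Longrightarrow> dist (p z) (p x) < - p x / 2"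
    using neg unfolding continuous_at_eps_delta by (metis divide_pos_pos neg_0_less_iff_less zero_less_numeral)
  define e where "e = d / (2 * real CARD('n))"
  have e: "e > 0" "real CARD('n) * e < d" using d by (auto simp: e_def field_simps)
  define y where "y = x + (\<chi> j. e)"
  have xy: "x $ j \<le> y $ j" for j using e by (simp add: y_def)
  have small: "p z \<le> p x / 2" if "z \<in> hbox x y" for z
  proof -
    have "dist z x \<le> (\<Sum>j\<in>UNIV. \<bar>(z - x) $ j\<bar>)"
      using norm_le_l1_cart[of "z - x"] by (simp only: dist_norm)
    also have "\<dots> \<le> (\<Sum>j\<in>(UNIV :: 'n set). e)"
    proof (rule sum_mono)
      fix j
      have "x $ j < z $ j \<and> z $ j \<le> x $ j + e" using that by (simp add: hbox_def y_def)
      thus "\<bar>(z - x) $ j\<bar> \<le> e" by simp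
    qed
    also have "\<dots> < d" using e by simp
    finally have "dist (p z) (p x) < - p x / 2" by (rule d)
    thus ?thesis by (simp add: dist_real_def)
  qed
  have "0 \<le> (\<integral>z. indicator (hbox x y) z * p z \<partial>lborel)" using xy by (rule nn)
  also have "\<dots> \<le> (\<integral>z. indicator (hbox x y) z * (p x / 2) \<partial>lborel)"
    using small by (intro integral_mono integrable_hbox p) (auto simp: indicator_def)
  also have "\<dots> = measure lborel (hbox x y) * (p x / 2)" by simp
  finally have "measure lborel (hbox x y) \<le> 0" using neg by (simp add: zero_le_mult_iff)
  moreover have "0 < measure lborel (box x y)"
  proof -
    have diff: "y \<bullet> b - x \<bullet> b = e" if "b \<in> Basis" for b
      using that by (auto simp: Basis_vec_def inner_axis y_def)
    have "x \<bullet> b \<le> y \<bullet> b" if "b \<in> Basis" for b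
      using diff[OF that] e by linarith
    with diff have "measure lborel (box x y) = (\<Prod>b\<in>(Basis :: (real ^ 'n) set). e)"
      by (subst measure_lborel_box) (auto simp: inner_diff_left intro!: prod.cong)
    thus ?thesis using e by (simp add: prod_pos)
  qed
  moreover have "measure lborel (box x y) \<le> measure lborel (hbox x y)"
  proof (rule measure_mono_fmeasurable)
    show "box x y \<subseteq> hbox x y" by (auto simp: hbox_def mem_box_cart intro: less_imp_le)
    have "hbox x y \<subseteq> cbox x y" by (auto simp: hbox_def mem_box_cart less_imp_le)
    thus "hbox x y \<in> fmeasurable lborel"
      by (rule fmeasurableI2[rotated 1]) auto
  qed auto
  ultimately show False by simp
qed

lemma AE_lborel_component_neq_0:
  "AE z :: real ^ 'n in lborel. \<forall>j. z $ j \<noteq> 0"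
proof -
  have "AE z :: real ^ 'n in lborel. z $ j \<noteq> 0" for j
  proof -
    have "negligible {z :: real ^ 'n. z $ j = 0}" by (rule negligible_standard_hyperplane_cart)
    hence "{z :: real ^ 'n. z $ j = 0} \<in> null_sets lebesgue" by (simp add: negligible_iff_null_sets)
    moreover have "{z :: real ^ 'n. z $ j = 0} \<in> sets borel" by measurable
    ultimately have "{z :: real ^ 'n. z $ j = 0} \<in> null_sets lborel"
      by (auto simp: null_sets_def)
    thus ?thesis by (rule AE_I'[of "{z. z $ j = 0}"]) auto
  qed
  thus ?thesis by (simp add: AE_all_countable)
qed

lemma measure_eq_if_atMost_eq:
  fixes \<mu> \<nu> :: "(real ^ 'n) measure"
  assumes \<mu>: "sets \<mu> = sets borel" "finite_measure \<mu>" and \<nu>: "sets \<nu> = sets borel"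
    and eq: "\<And>u. emeasure \<mu> {..u} = emeasure \<nu> {..u}"
  shows "\<mu> = \<nu>"
proof (rule measure_eqI_generator_eq)
  let ?E = "range (\<lambda>u :: real ^ 'n. {..u})"
  have "sets (borel :: (real ^ 'n) measure) = sigma_sets UNIV ?E"
    unfolding borel_eq_atMost by (rule sets_measure_of) auto
  thus "sets \<mu> = sigma_sets UNIV ?E" "sets \<nu> = sigma_sets UNIV ?E" using \<mu> \<nu> by auto
  have "{..u} \<inter> {..v} = {..inf u v}" for u v :: "real ^ 'n" by auto
  thus "Int_stable ?E" by (auto simp: Int_stable_def)
  show "emeasure \<mu> A = emeasure \<nu> A" if "A \<in> ?E" for A using that eq by auto
  show "range (\<lambda>k. {.. (\<chi> j. real k)}) \<subseteq> ?E" by auto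
  have "\<exists>k. z \<in> {.. (\<chi> j. real k)}" for z :: "real ^ 'n"
  proof -
    obtain k where k: "norm z \<le> real k" using real_arch_simple by blast
    have "z $ j \<le> real k" for j
      using component_le_norm_cart[of z j] k by linarith
    thus ?thesis by (auto simp: less_eq_vec_def intro!: exI[of _ k])
  qed
  thus "(\<Union>k. {.. (\<chi> j. real k)}) = (UNIV :: (real ^ 'n) set)" by auto
  show "emeasure \<mu> {.. (\<chi> j. real k)} \<noteq> \<infinity>" for k
    using finite_measure.emeasure_finite[OF \<mu>(2)] by auto
qed auto

lemma finite_event_sets:
  fixes X :: "'n::finite \<Rightarrow> 'b \<Rightarrow> ereal"
  assumes [measurable]: "\<And>j. X j \<in> borel_measurable N"
  shows "finite_event N X \<in> sets N"
  unfolding finite_event_def by measurable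

lemma borel_measurable_real_of_ereal_vec:
  fixes X :: "'n::finite \<Rightarrow> 'b \<Rightarrow> ereal"
  assumes [measurable]: "\<And>j. X j \<in> borel_measurable N"
  shows "(\<lambda>\<omega>. \<chi> j. real_of_ereal (X j \<omega>)) \<in> borel_measurable N"
  by (subst borel_measurable_euclidean_space) (auto simp: Basis_vec_def inner_axis)

lemma has_orthant_density_0:
  fixes X :: "'n::finite \<Rightarrow> 'b \<Rightarrow> ereal"
  assumes X: "\<And>j. X j \<in> borel_measurable N" and null: "AE \<omega> in N. \<omega> \<notin> finite_event N X"
  shows "has_orthant_density N X (\<lambda>_. 0)"
proof -
  let ?Y = "\<lambda>\<omega>. \<chi> j. real_of_ereal (X j \<omega>)"
  let ?R = "restrict_space N (finite_event N X)"
  have FE: "finite_event N X \<in> sets N" by (rule finite_event_sets[OF X])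
  have em: "emeasure N (finite_event N X) = 0"
    using null FE by (subst (asm) AE_iff_measurable[OF FE]) (auto dest: sets.sets_into_space)
  have Y: "?Y \<in> borel_measurable ?R"
    by (intro measurable_restrict_space1 borel_measurable_real_of_ereal_vec X)
  have "distr ?R lborel ?Y = density lborel (\<lambda>_. 0)"
  proof (rule measure_eqI)
    fix A assume "A \<in> sets (distr ?R lborel ?Y)"
    hence A: "A \<in> sets borel" by simp
    have "emeasure (distr ?R lborel ?Y) A = emeasure ?R (?Y -` A \<inter> space ?R)"
      using A Y by (subst emeasure_distr) auto
    also have "\<dots> \<le> emeasure N (finite_event N X)"
      using measurable_sets[OF Y A] FE
      by (subst emeasure_restrict_space) (auto simp: space_restrict_space sets.Int_space_eq2 intro!: emeasure_mono)
    finally show "emeasure (distr ?R lborel ?Y) A = emeasure (density lborel (\<lambda>_. 0)) A"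
      using em A by (simp add: emeasure_density)
  qed simp
  thus ?thesis using Y by (simp add: has_orthant_density_def distributed_def)
qed

text \<open>The density is nonnegative because it integrates to probabilities over boxes. The laws agree on the
  lower sets \<open>{..u}\<close>: up to null events these are boxes with lower corner 0, as \<open>X\<close> is positive almost
  surely and the boundary of the orthant has Lebesgue measure zero.\<close>

lemma has_orthant_densityI:
  fixes X :: "'n::finite \<Rightarrow> 'b \<Rightarrow> ereal" and p :: "real ^ 'n \<Rightarrow> real"
  assumes N: "prob_space N" and X [measurable]: "\<And>j. X j \<in> borel_measurable N"
    and pos: "AE \<omega> in N. \<forall>j. 0 < X j \<omega>"
    and p: "continuous_on UNIV p"
    and box: "\<And>x y. x \<in> nonneg_orthant \<Longrightarrow> (\<And>j. x $ j \<le> y $ j) \<Longrightarrow>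
       measure N {\<omega> \<in> space N. \<forall>j. ereal (x $ j) < X j \<omega> \<and> X j \<omega> \<le> ereal (y $ j)} =
         (\<integral>z. indicator (hbox x y) z * p z \<partial>lborel)"
  shows "has_orthant_density N X p"
proof -
  interpret prob_space N by fact
  have nn: "0 \<le> p x" if "x \<in> nonneg_orthant" for x
  proof (rule nonneg_if_hbox_integrals_nonneg[OF p])
    fix y assume "\<And>j. x $ j \<le> y $ j"
    from box[OF that this, symmetric] show "0 \<le> (\<integral>z. indicator (hbox x y) z * p z \<partial>lborel)"
      by (simp only: measure_nonneg)
  qed
  let ?Y = "\<lambda>\<omega>. \<chi> j. real_of_ereal (X j \<omega>)"
  let ?F = "finite_event N X"
  let ?R = "restrict_space N ?F"
  let ?f = "\<lambda>x. ennreal (indicator nonneg_orthant x * p x)"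
  have FE [measurable]: "?F \<in> sets N" by (rule finite_event_sets[OF X])
  have Y0 [measurable]: "?Y \<in> borel_measurable N"
    by (intro borel_measurable_real_of_ereal_vec X)
  have Y: "?Y \<in> borel_measurable ?R"
    by (intro measurable_restrict_space1 Y0)
  have [measurable]: "p \<in> borel_measurable borel" by (rule borel_measurable_continuous_onI[OF p])
  have [measurable]: "(nonneg_orthant :: (real ^ 'n) set) \<in> sets borel"
    unfolding nonneg_orthant_def by measurable
  have fR: "finite_measure ?R" by (rule finite_measure_restrict_space) auto
  have "distr ?R borel ?Y = density lborel ?f"
  proof (rule measure_eq_if_atMost_eq)
    show "finite_measure (distr ?R borel ?Y)"
      by (rule finite_measure.finite_measure_distr[OF fR Y])
    fix u :: "real ^ 'n"
    \<comment> \<open>truncation at 0 turns \<open>{..u}\<close> into a box with corners \<open>0 \<le> v\<close>, which is empty if \<open>u\<close> has a negative coordinate\<close>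
    define v where "v = (\<chi> j. max (u $ j) 0)"
    have v: "0 $ j \<le> v $ j" for j by (simp add: v_def)
    have z0: "(0 :: real ^ 'n) \<in> nonneg_orthant" by (simp add: nonneg_orthant_def)
    have "emeasure (distr ?R borel ?Y) {..u} = emeasure ?R (?Y -` {..u} \<inter> space ?R)"
      using Y by (subst emeasure_distr) auto
    also have "\<dots> = emeasure N (?Y -` {..u} \<inter> space ?R)"
      by (subst emeasure_restrict_space) (auto simp: space_restrict_space)
    also have "?Y -` {..u} \<inter> space ?R = {\<omega> \<in> space N. \<omega> \<in> ?F \<and> ?Y \<omega> \<le> u}"
      by (auto simp: space_restrict_space finite_event_def)
    also have "emeasure N \<dots> = emeasure N {\<omega> \<in> space N. \<forall>j. ereal (0 $ j) < X j \<omega> \<and> X j \<omega> \<le> ereal (v $ j)}"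
    proof (rule emeasure_eq_AE)
      show "AE \<omega> in N. (\<omega> \<in> {\<omega> \<in> space N. \<omega> \<in> ?F \<and> ?Y \<omega> \<le> u}) \<longleftrightarrow> 
          (\<omega> \<in> {\<omega> \<in> space N. \<forall>j. ereal (0 $ j) < X j \<omega> \<and> X j \<omega> \<le> ereal (v $ j)})"
        using pos
      proof eventually_elim
        case (elim \<omega>)
        have iff: "(\<bar>X j \<omega>\<bar> \<noteq> \<infinity> \<and> real_of_ereal (X j \<omega>) \<le> u $ j) \<longleftrightarrow> X j \<omega> \<le> ereal (v $ j)" for j
          using elim[rule_format, of j] by (cases "X j \<omega>"; cases "u $ j \<le> 0") (auto simp: v_def max_def)
        show ?case
          using elim unfolding finite_event_def less_eq_vec_def mem_Collect_eq iff[symmetric]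
          by (simp add: all_conj_distrib flip: zero_ereal_def)
      qed
      have "{\<omega> \<in> space N. \<omega> \<in> ?F \<and> ?Y \<omega> \<le> u} = ?F \<inter> (?Y -` {..u} \<inter> space N)" by (auto simp: finite_event_def)
      thus "{\<omega> \<in> space N. \<omega> \<in> ?F \<and> ?Y \<omega> \<le> u} \<in> sets N" 
        using FE measurable_sets[OF Y0, of "{..u}"] by (simp add: sets.Int)
    qed measurable
    also have "\<dots> = ennreal (\<integral>z. indicator (hbox 0 v) z * p z \<partial>lborel)"
      unfolding emeasure_eq_measure box[OF z0 v] ..
    also have "\<dots> = (\<integral>\<^sup>+z. ennreal (indicator (hbox 0 v) z * p z) \<partial>lborel)"
      using nn by (intro nn_integral_eq_integral[symmetric] integrable_hbox p always_eventually)
        (auto simp: indicator_def hbox_def nonneg_orthant_def less_imp_le)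
    also have "\<dots> = (\<integral>\<^sup>+z. ?f z * indicator {..u} z \<partial>lborel)"
    proof (rule nn_integral_cong_AE)
      show "AE z in lborel. ennreal (indicator (hbox 0 v) z * p z) = ?f z * indicator {..u} z"
        using AE_lborel_component_neq_0
      proof eventually_elim
        case (elim z)
        have "(0 < z $ j \<and> z $ j \<le> v $ j) \<longleftrightarrow> (0 \<le> z $ j \<and> z $ j \<le> u $ j)" for j
          using elim[rule_format, of j] by (auto simp: v_def)
        hence "z \<in> hbox 0 v \<longleftrightarrow> z \<in> nonneg_orthant \<and> z \<in> {..u}"
          by (auto simp: hbox_def nonneg_orthant_def less_eq_vec_def)
        thus ?case by (simp add: indicator_def)
      qed
    qed
    also have "\<dots> = emeasure (density lborel ?f) {..u}"
      by (subst emeasure_density) auto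
    finally show "emeasure (distr ?R borel ?Y) {..u} = emeasure (density lborel ?f) {..u}" .
  qed auto
  moreover have "distr ?R lborel ?Y = distr ?R borel ?Y" by (rule distr_cong) auto
  ultimately show ?thesis using nn Y by (simp add: has_orthant_density_def distributed_def)
qed

section \<open>The inverse process\<close>

lemma prob_stable_sum_less_le:
  fixes a x :: "real ^ 'n"
  assumes \<beta>: "0 < \<beta>" and a: "\<And>j. 0 \<le> a $ j" and H: "\<And>j. stable_subordinator \<beta> M (H j)"
    and indep: "independent_processes M H" and x: "x \<in> nonneg_orthant"
  shows "measure M {\<omega> \<in> space M. stable_sum \<beta> a H x \<omega> < t} \<le> exp (t - a \<bullet> x)"
proof -
  have "measure M {\<omega> \<in> space M. stable_sum \<beta> a H x \<omega> < t} = measure (distr M borel (stable_sum \<beta> a H x)) {..<t}"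
    using borel_measurable_stable_sum[OF H x, of a] by (subst measure_distr) (auto intro!: arg_cong[where f = "measure M"])
  also have "\<dots> \<le> exp (t - a \<bullet> x)"
    by (rule stable_law_lessThan_le[OF stable_sum_law[OF \<beta> a H indep x]])
  finally show ?thesis .
qed

context
  fixes \<beta> t :: real and a :: "real ^ 'n" and M :: "'a measure" and H :: "'n \<Rightarrow> real \<Rightarrow> 'a \<Rightarrow> real"
    and N :: "'b measure" and X :: "'n \<Rightarrow> 'b \<Rightarrow> ereal"
  assumes \<beta>: "0 < \<beta>" "\<beta> < 1" and a: "\<And>j. 0 \<le> a $ j" and H: "\<And>j. stable_subordinator \<beta> M (H j)"
    and indep: "independent_processes M H" and t: "0 < t"
    and inv: "is_inverse_at N X M (stable_sum \<beta> a H) t"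
begin

lemma inverse_prob_space: "prob_space N" and inverse_measurable: "X j \<in> borel_measurable N"
  using inv by (auto simp: is_inverse_at_def)

lemma inverse_survival:
  assumes "x \<in> nonneg_orthant"
  shows "measure N {\<omega> \<in> space N. \<forall>j. ereal (x $ j) < X j \<omega>} = wright (- \<beta>) 1 (- (a \<bullet> x) / t powr \<beta>)"
  using inv assms prob_stable_sum_less[OF \<beta> a H indep assms t] by (simp add: is_inverse_at_def)

lemma AE_inverse_greater:
  assumes x: "x \<in> nonneg_orthant" and "a \<bullet> x = 0"
  shows "AE \<omega> in N. \<forall>j. ereal (x $ j) < X j \<omega>"
proof -
  interpret prob_space N by (rule inverse_prob_space)
  note [measurable] = inverse_measurable
  have "measure N {\<omega> \<in> space N. \<forall>j. ereal (x $ j) < X j \<omega>} = 1"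
    using inverse_survival[OF x] assms(2) by simp
  moreover have "{\<omega> \<in> space N. \<forall>j. ereal (x $ j) < X j \<omega>} \<in> sets N" by measurable
  ultimately have "AE \<omega> in N. \<omega> \<in> {\<omega> \<in> space N. \<forall>j. ereal (x $ j) < X j \<omega>}"
    by (subst (asm) prob_eq_1) auto
  thus ?thesis by eventually_elim auto
qed

lemma AE_inverse_pos: "AE \<omega> in N. \<forall>j. 0 < X j \<omega>"
  using AE_inverse_greater[of 0] by (simp add: nonneg_orthant_def flip: zero_ereal_def)

text \<open>The survival function does not depend on \<open>x $ i\<close> if \<open>a $ i = 0\<close>.\<close>

lemma AE_inverse_infinite:
  assumes "a $ i = 0"
  shows "AE \<omega> in N. X i \<omega> = \<infinity>"
proof -
  have "AE \<omega> in N. ereal (real k) < X i \<omega>" for k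
  proof -
    have "axis i (real k) \<in> nonneg_orthant" by (simp add: nonneg_orthant_def axis_def)
    moreover have "a \<bullet> axis i (real k) = 0" using assms by (simp add: inner_axis)
    ultimately have "AE \<omega> in N. \<forall>j. ereal (axis i (real k) $ j) < X j \<omega>"
      by (rule AE_inverse_greater)
    thus ?thesis
      by eventually_elim (metis axis_nth)
  qed
  hence "AE \<omega> in N. \<forall>k. ereal (real k) < X i \<omega>" by (simp add: AE_all_countable)
  thus ?thesis
  proof eventually_elim
    case (elim \<omega>)
    have lt: "ereal r < X i \<omega>" for r
    proof -
      obtain k where "r \<le> real k" using real_arch_simple by blast
      hence "ereal r \<le> ereal (real k)" by simp
      also have "\<dots> < X i \<omega>" using elim by blast
      finally show ?thesis .
    qed
    show ?case
    proof (cases "X i \<omega>")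
      case (real r)
      with lt[of r] show ?thesis by simp
    qed (use lt[of 0] in auto)
  qed
qed

text \<open>Along the axis \<open>i\<close> the survival function is at most \<open>exp (t - a $ i * x $ i)\<close>.\<close>

lemma AE_inverse_finite:
  assumes pos: "0 < a $ i"
  shows "AE \<omega> in N. X i \<omega> < \<infinity>"
proof -
  interpret prob_space N by (rule inverse_prob_space)
  note [measurable] = inverse_measurable
  let ?E = "{\<omega> \<in> space N. X i \<omega> = \<infinity>}"
  have [measurable]: "?E \<in> sets N" by measurable
  have "measure N ?E \<le> exp (t - a $ i * real k)" for k
  proof -
    have o: "axis i (real k) \<in> nonneg_orthant" by (auto simp: nonneg_orthant_def axis_def)
    have "measure N ?E \<le> measure N {\<omega> \<in> space N. \<forall>j. ereal (axis i (real k) $ j) < X j \<omega>}"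
    proof (rule finite_measure_mono_AE)
      show "AE \<omega> in N. \<omega> \<in> ?E \<longrightarrow> \<omega> \<in> {\<omega> \<in> space N. \<forall>j. ereal (axis i (real k) $ j) < X j \<omega>}"
        using AE_inverse_pos by eventually_elim (auto simp: axis_def simp flip: zero_ereal_def)
    qed measurable
    also have "\<dots> = measure M {\<omega> \<in> space M. stable_sum \<beta> a H (axis i (real k)) \<omega> < t}"
      using inv o by (simp add: is_inverse_at_def)
    also have "\<dots> \<le> exp (t - a \<bullet> axis i (real k))"
      by (rule prob_stable_sum_less_le[OF \<beta>(1) a H indep o])
    finally show ?thesis by (simp add: inner_axis mult.commute)
  qed
  moreover have "(\<lambda>k. exp (t - a $ i * real k)) \<longlonglongrightarrow> 0" using pos by real_asymp
  ultimately have "measure N ?E \<le> 0" by (intro LIMSEQ_le_const) auto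
  hence "AE \<omega> in N. \<omega> \<notin> ?E" by (subst prob_eq_0[symmetric]) (auto intro: antisym)
  thus ?thesis using AE_space by eventually_elim auto
qed

lemma AE_finite_event:
  assumes "\<And>j. 0 < a $ j"
  shows "AE \<omega> in N. \<omega> \<in> finite_event N X"
proof -
  have "AE \<omega> in N. \<forall>j\<in>UNIV. X j \<omega> < \<infinity>"
    using AE_inverse_finite[OF assms] by (intro AE_finite_allI) auto
  thus ?thesis using AE_inverse_pos AE_space
  proof eventually_elim
    case (elim \<omega>)
    have "\<bar>X j \<omega>\<bar> \<noteq> \<infinity>" for j
      using elim(1)[rule_format, of j] elim(2)[rule_format, of j] by (cases "X j \<omega>") auto
    thus ?case using elim(3) by (simp add: finite_event_def)
  qed
qed

text \<open>If all weights are positive, the survival function is \<open>V 0 (- (c \<bullet> x))\<close> with \<open>c = a / t powr \<beta>\<close>. If a weight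
  vanishes, a coordinate of \<open>X\<close> is infinite, and the proposed density is zero.\<close>

lemma inverse_has_orthant_density:
  "has_orthant_density N X
     (\<lambda>x. (\<Prod>j\<in>UNIV. a $ j) / t powr (real CARD('n) * \<beta>) *
        wright (- \<beta>) (1 - real CARD('n) * \<beta>) (- (a \<bullet> x) / t powr \<beta>))"
proof (cases "\<exists>i. a $ i = 0")
  case True
  then obtain i where i: "a $ i = 0" by blast
  have "AE \<omega> in N. \<omega> \<notin> finite_event N X"
    using AE_inverse_infinite[OF i] by eventually_elim (auto simp: finite_event_def intro!: exI[of _ i])
  hence "has_orthant_density N X (\<lambda>_. 0)" by (rule has_orthant_density_0[OF inverse_measurable])
  moreover have "(\<Prod>j\<in>UNIV. a $ j) = 0" using i by (intro prod_zero) auto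
  ultimately show ?thesis by (simp only: div_0 mult_zero_left)
next
  case False
  define c where "c = (1 / t powr \<beta>) *\<^sub>R a"
  define V where "V = (\<lambda>m. wright (- \<beta>) (1 - real m * \<beta>) :: real \<Rightarrow> real)"
  have V: "(V m has_real_derivative V (Suc m) u) (at u)" for m u
    unfolding V_def by (rule DERIV_wright[OF \<beta>])
  have prod_c: "(\<Prod>j\<in>UNIV. c $ j) = (\<Prod>j\<in>UNIV. a $ j) / t powr (real CARD('n) * \<beta>)"
    using t by (simp add: c_def prod_dividef powr_powr[symmetric] powr_realpow mult.commute)
  have p: "(\<Prod>j\<in>UNIV. c $ j) * V CARD('n) (- (c \<bullet> x)) = (\<Prod>j\<in>UNIV. a $ j) / t powr (real CARD('n) * \<beta>) *
        wright (- \<beta>) (1 - real CARD('n) * \<beta>) (- (a \<bullet> x) / t powr \<beta>)" for x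
    unfolding prod_c by (simp add: V_def c_def)
  have "has_orthant_density N X (\<lambda>x. (\<Prod>j\<in>UNIV. c $ j) * V CARD('n) (- (c \<bullet> x)))"
  proof (rule has_orthant_densityI[OF inverse_prob_space inverse_measurable AE_inverse_pos])
    have "continuous_on UNIV (V m)" for m
      unfolding V_def by (rule continuous_on_wright[OF \<beta>])
    hence "continuous_on UNIV (\<lambda>x. V CARD('n) (- (c \<bullet> x)))"
      by (rule continuous_on_compose2) (auto intro!: continuous_intros)
    thus "continuous_on UNIV (\<lambda>x. (\<Prod>j\<in>UNIV. c $ j) * V CARD('n) (- (c \<bullet> x)))"
      by (intro continuous_on_mult continuous_on_const)
    fix x y :: "real ^ 'n" assume xy: "x \<in> nonneg_orthant" "\<And>j. x $ j \<le> y $ j"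
    show "measure N {\<omega> \<in> space N. \<forall>j. ereal (x $ j) < X j \<omega> \<and> X j \<omega> \<le> ereal (y $ j)} =
        (\<integral>z. indicator (hbox x y) z * ((\<Prod>j\<in>UNIV. c $ j) * V CARD('n) (- (c \<bullet> z))) \<partial>lborel)"
    proof (rule measure_hbox_eq_integral[where V = V and c = c])
      show "0 \<le> c $ j" for j using a[of j] by (simp add: c_def)
      show "measure N {\<omega> \<in> space N. \<forall>j. ereal (x $ j) < X j \<omega>} = V 0 (- (c \<bullet> x))"
        if "x \<in> nonneg_orthant" for x
        using inverse_survival[OF that] by (simp add: V_def c_def)
    qed (rule inverse_prob_space inverse_measurable V xy)+
  qed
  thus ?thesis unfolding p .
qed

end

theorem mainTheorem7:
  fixes \<beta> :: real
    and a :: "real ^ 'n"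
    and M :: "'a measure"
    and H :: "'n \<Rightarrow> real \<Rightarrow> 'a \<Rightarrow> real"
    and M\<^sub>0 :: "'c measure"
    and G :: "real \<Rightarrow> 'c \<Rightarrow> real"
    and h :: "real \<Rightarrow> real \<Rightarrow> real"
    and N :: "'b measure"
  assumes "0 < \<beta>" and "\<beta> < 1"
    and "\<forall>j. 0 \<le> a $ j" and "norm a = 1"
    and "\<forall>j. stable_subordinator \<beta> M (H j)"
    and "independent_processes M H"
  shows
    "(stable_subordinator \<beta> M\<^sub>0 G \<and>
       (\<forall>\<tau>>0. (\<forall>s. 0 \<le> h s \<tau>) \<and> distributed M\<^sub>0 lborel (G \<tau>) (\<lambda>s. ennreal (h s \<tau>))) \<longrightarrow>
       (\<forall>x\<in>nonneg_orthant. 0 < a \<bullet> x \<longrightarrow>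
          distributed M lborel (stable_sum \<beta> a H x) (\<lambda>s. ennreal (h s (a \<bullet> x))))) \<and>
     (\<forall>x\<in>nonneg_orthant. a \<bullet> x = 0 \<longrightarrow> distr M borel (stable_sum \<beta> a H x) = return borel 0) \<and>
     (\<forall>t>0. \<forall>X. is_inverse_at N X M (stable_sum \<beta> a H) t \<longrightarrow>
        has_orthant_density N X
          (\<lambda>x. (\<Prod>j\<in>UNIV. a $ j) / t powr (real CARD('n) * \<beta>) *
               wright (- \<beta>) (1 - real CARD('n) * \<beta>) (- (a \<bullet> x) / t powr \<beta>)) \<and>
        ((\<forall>j. 0 < a $ j) \<longrightarrow> (AE \<omega> in N. \<omega> \<in> finite_event N X)))"
proof (intro conjI impI ballI allI)
  note \<beta> = assms(1,2)
  have a: "0 \<le> a $ j" and H: "stable_subordinator \<beta> M (H j)" for j using assms by auto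
  note indep = assms(6)
  fix x :: "real ^ 'n" assume x: "x \<in> nonneg_orthant"
  {
    assume "stable_subordinator \<beta> M\<^sub>0 G \<and>
       (\<forall>\<tau>>0. (\<forall>s. 0 \<le> h s \<tau>) \<and> distributed M\<^sub>0 lborel (G \<tau>) (\<lambda>s. ennreal (h s \<tau>)))" "0 < a \<bullet> x"
    thus "distributed M lborel (stable_sum \<beta> a H x) (\<lambda>s. ennreal (h s (a \<bullet> x)))"
      by (intro stable_sum_density[OF \<beta> a H indep x]) auto
  }
  assume "a \<bullet> x = 0"
  thus "distr M borel (stable_sum \<beta> a H x) = return borel 0"
    using stable_sum_law[OF \<beta>(1) a H indep x] by (intro stable_law_0) simp
next
  have a: "0 \<le> a $ j" and H: "stable_subordinator \<beta> M (H j)" for j using assms by auto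
  fix t :: real and X assume "0 < t" and inv: "is_inverse_at N X M (stable_sum \<beta> a H) t"
  note * = assms(1,2) a H assms(6) this
  show "has_orthant_density N X
          (\<lambda>x. (\<Prod>j\<in>UNIV. a $ j) / t powr (real CARD('n) * \<beta>) *
               wright (- \<beta>) (1 - real CARD('n) * \<beta>) (- (a \<bullet> x) / t powr \<beta>))"
    by (rule inverse_has_orthant_density[OF *])
  assume "\<forall>j. 0 < a $ j"
  thus "AE \<omega> in N. \<omega> \<in> finite_event N X"
    by (intro AE_finite_event[OF *]) auto
qed

end
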